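(* There exists a germ $f(z)=e^{2\pi i\alpha}z+O(z^2)$ of holomorphic diffeomorphism fixing $0\in\mathbb{C}$, with $\alpha\in\mathbb{R}\setminus\mathbb{Q}$, which is non-linearizable and which has a hedgehog $K$ of positive two-dimensional Lebesgue measure.
   Context: A germ $f(z)=e^{2\pi i\alpha}z+O(z^2)$ with $\alpha\in\mathbb{R}\setminus\mathbb{Q}$ is called linearizable if it is holomorphically conjugate near $0$ to the rotation $R_\alpha(z)=e^{2\pi i\alpha}z$, and non-linearizable otherwise. By a theorem of Perez-Marco, if $f$ is univalent on a neighbourhood of the closure of a Jordan domain $U\ni 0$, there exist compact, connected, full sets $K\subset\overline{U}$ with $0\in K$, $K\cap\partial U\neq\emptyset$, and $f(K)=K=f^{-1}(K)$ (Siegel compacta); when $f$ is non-linearizable such an invariant compact set $K\neq\{0\}$ is called a hedgehog of $f$. Area means Lebesgue measure on $\mathbb{C}$. *)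

theory Defs
  imports "HOL-Complex_Analysis.Complex_Analysis"
begin

definition rot :: "real \<Rightarrow> complex \<Rightarrow> complex" where
  "rot \<alpha> z = exp (2 * of_real pi * \<i> * of_real \<alpha>) * z"

definition irrational_rotation_germ :: "(complex \<Rightarrow> complex) \<Rightarrow> real \<Rightarrow> bool" where
  "irrational_rotation_germ f \<alpha> \<longleftrightarrow> \<alpha> \<notin> \<rat> \<and>
     (\<exists>V. open V \<and> 0 \<in> V \<and> f holomorphic_on V) \<and>
     f 0 = 0 \<and> deriv f 0 = exp (2 * of_real pi * \<i> * of_real \<alpha>)"

definition linearizable :: "(complex \<Rightarrow> complex) \<Rightarrow> real \<Rightarrow> bool" where
  "linearizable f \<alpha> \<longleftrightarrow>
     (\<exists>V h r. open V \<and> 0 \<in> V \<and> h holomorphic_on V \<and> inj_on h V \<and> h 0 = 0 \<and> r > 0 \<and>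
        (\<forall>z\<in>ball 0 r. z \<in> V \<and> f z \<in> V \<and> h (f z) = rot \<alpha> (h z)))"

definition jordan_domain :: "complex set \<Rightarrow> bool" where
  "jordan_domain U \<longleftrightarrow> (\<exists>g. simple_path g \<and> pathfinish g = pathstart g \<and>
                              U = inside (path_image g))"

definition full :: "complex set \<Rightarrow> bool" where
  "full K \<longleftrightarrow> connected (- K)"

definition siegel_compactum ::
  "(complex \<Rightarrow> complex) \<Rightarrow> complex set \<Rightarrow> complex set \<Rightarrow> complex set \<Rightarrow> bool" where
  "siegel_compactum f W U K \<longleftrightarrow>
     jordan_domain U \<and> 0 \<in> U \<and> open W \<and> closure U \<subseteq> W \<and>
     f holomorphic_on W \<and> inj_on f W \<and>
     compact K \<and> connected K \<and> full K \<and> 0 \<in> K \<and> K \<subseteq> closure U \<and>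
     K \<inter> frontier U \<noteq> {} \<and> f ` K = K \<and> {z \<in> W. f z \<in> K} = K"

definition hedgehog :: "(complex \<Rightarrow> complex) \<Rightarrow> real \<Rightarrow> complex set \<Rightarrow> bool" where
  "hedgehog f \<alpha> K \<longleftrightarrow> \<not> linearizable f \<alpha> \<and> K \<noteq> {0} \<and>
     (\<exists>W U. siegel_compactum f W U K)"

end

theory Submission
  imports Defs
begin

text \<open>
  The germ is the limit of maps \<open>f\<^sub>n\<close> with rational rotation numbers \<open>\<alpha>\<^sub>n = p\<^sub>n / q\<^sub>n\<close>, in the style of
  Anosov and Katok. Each \<open>f\<^sub>n\<close> preserves an entire function \<open>U\<^sub>n\<close>, and a univalent chart
  \<open>\<Psi>\<^sub>n\<close> of a disc satisfies \<open>U\<^sub>n (\<Psi>\<^sub>n w) = w ^ q\<^sub>n\<close>, so that \<open>f\<^sub>n\<close> rotates the image of \<open>\<Psi>\<^sub>n\<close>.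
  The field \<open>X\<^sub>n = 2 \<pi> \<i> q\<^sub>n U\<^sub>n / U\<^sub>n'\<close> is entire. For a locally univalent entire \<open>F\<close> with
  \<open>F 0 = 0\<close>, put \<open>U\<^sub>n\<^sub>+\<^sub>1 = (F \<circ> U\<^sub>n) ^ m\<close>: the new field is again entire, its flow at time
  \<open>1 / (m q\<^sub>n)\<close> preserves \<open>U\<^sub>n\<^sub>+\<^sub>1\<close> and tends to the identity as \<open>m\<close> grows, and \<open>f\<^sub>n\<^sub>+\<^sub>1\<close> is its
  composition with \<open>f\<^sub>n\<close>. Runge's theorem provides an \<open>F\<close> that is close to the Riemann map of
  a disc slit almost down to the centre, so that the new chart loses very little area, and that
  has a zero close to \<open>0\<close>. Such a zero gives a cycle near \<open>0\<close> common to \<open>f\<^sub>n\<close> and all later maps, so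
  the limit has cycles accumulating at \<open>0\<close> and is not linearizable. The filled upper limit of the
  chart images is an invariant continuum; its area is positive because area is upper
  semicontinuous.
\<close>

subsection \<open>Approximation by entire functions\<close>

text \<open>The charts cannot keep a common disc around \<open>0\<close>, because the cycles near
  \<open>0\<close> forbid it, and yet their area has to survive. A slit reconciles the two: it has
  area zero and can end as close to the centre as desired. The new zero of \<open>F\<close> must lie
  off the image of \<open>T\<close>, since \<open>F (T v) = v\<close> makes \<open>F\<close>
  injective there and \<open>F 0 = 0\<close> already; it is therefore sought near the tip of the
  slit. Local univalence is the right demand on \<open>F\<close>: an injective entire function is
  affine and has no second zero, while \<open>F 0 = 0\<close> and a zero-free derivative make
  \<open>F u / (u * deriv F u)\<close>, hence the new field, entire. Zeros of one integral map are
  zeros of all later ones and rest points of the later fields, so later flows do not move the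
  cycles. The radii 2, 3, 4, 5 are those of the balls for the charts, for injectivity of the limit,
  for the germs and for the flows; all displacements add up to at most 1/2, which leaves room
  between consecutive balls.\<close>

definition entire_approx :: "complex set \<Rightarrow> (complex \<Rightarrow> complex) \<Rightarrow> bool" where
  "entire_approx L f \<longleftrightarrow>
     (\<forall>e>0. \<exists>p. p holomorphic_on UNIV \<and> (\<forall>u\<in>L. norm (f u - p u) < e))"

lemma entire_approx_holomorphic: "p holomorphic_on UNIV \<Longrightarrow> entire_approx L p"
  unfolding entire_approx_def by (metis diff_self norm_zero)

lemma entire_approx_add:
  assumes "entire_approx L f" "entire_approx L g"
  shows "entire_approx L (\<lambda>u. f u + g u)"
  unfolding entire_approx_def
proof (intro allI impI)
  fix e :: real assume "e > 0"
  then obtain p q where "p holomorphic_on UNIV" "q holomorphic_on UNIV"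
    and "\<forall>u\<in>L. norm (f u - p u) < e/2" "\<forall>u\<in>L. norm (g u - q u) < e/2"
    using assms unfolding entire_approx_def by (meson half_gt_zero)
  moreover have "norm ((f u + g u) - (p u + q u)) < e"
    if "norm (f u - p u) < e/2" "norm (g u - q u) < e/2" for u
    using norm_diff_triangle_ineq[of "f u" "g u" "p u" "q u"] that by linarith
  ultimately show "\<exists>p. p holomorphic_on UNIV \<and> (\<forall>u\<in>L. norm (f u + g u - p u) < e)"
    by (intro exI[of _ "\<lambda>u. p u + q u"]) (auto intro!: holomorphic_intros)
qed

lemma entire_approx_mult:
  assumes f: "entire_approx L f" and g: "entire_approx L g"
    and Bf: "\<And>u. u \<in> L \<Longrightarrow> norm (f u) \<le> B" and Bg: "\<And>u. u \<in> L \<Longrightarrow> norm (g u) \<le> B"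
  shows "entire_approx L (\<lambda>u. f u * g u)"
  unfolding entire_approx_def
proof (intro allI impI)
  fix e :: real assume e: "e > 0"
  define b where "b = \<bar>B\<bar> + 1"
  have b: "b \<ge> 1" by (simp add: b_def)
  define d where "d = min 1 (e / (2*b))"
  have d: "d > 0" "d \<le> 1" "d * (2 * b) \<le> e" using e b by (auto simp: d_def min_def field_simps)
  obtain p q where pq: "p holomorphic_on UNIV" "q holomorphic_on UNIV"
    and pd: "\<forall>u\<in>L. norm (f u - p u) < d" and qd: "\<forall>u\<in>L. norm (g u - q u) < d"
    using f g d unfolding entire_approx_def by meson
  have "norm (f u * g u - p u * q u) < e" if u: "u \<in> L" for u
  proof -
    have nf: "norm (f u) < b" using Bf[OF u] by (simp add: b_def)
    have "norm (q u) \<le> norm (g u) + norm (g u - q u)"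
      by (metis norm_minus_commute norm_triangle_sub)
    hence nq: "norm (q u) < b" using Bg[OF u] qd u d by (fastforce simp: b_def)
    have "f u * g u - p u * q u = f u * (g u - q u) + (f u - p u) * q u" by (simp add: algebra_simps)
    hence "norm (f u * g u - p u * q u) \<le> norm (f u) * norm (g u - q u) + norm (f u - p u) * norm (q u)"
      by (metis norm_mult norm_triangle_ineq)
    also have "\<dots> \<le> norm (f u) * d + d * norm (q u)"
      using pd qd u by (intro add_mono mult_left_mono mult_right_mono) (auto simp: less_imp_le)
    also have "\<dots> < b * d + d * b"
      using nf nq d by (intro add_strict_mono mult_strict_right_mono mult_strict_left_mono) auto
    finally show ?thesis using d by (simp add: algebra_simps)
  qed
  thus "\<exists>p. p holomorphic_on UNIV \<and> (\<forall>u\<in>L. norm (f u * g u - p u) < e)"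
    using pq by (intro exI[of _ "\<lambda>u. p u * q u"]) (auto intro!: holomorphic_intros)
qed

lemma entire_approx_cmult:
  assumes "entire_approx L f" shows "entire_approx L (\<lambda>u. c * f u)"
  unfolding entire_approx_def
proof (intro allI impI)
  fix e :: real assume e: "e > 0"
  obtain p where p: "p holomorphic_on UNIV" "\<forall>u\<in>L. norm (f u - p u) < e / (norm c + 1)"
    using assms e unfolding entire_approx_def
    by (meson add_nonneg_pos divide_pos_pos norm_ge_zero zero_less_one)
  have "norm (c * f u - c * p u) < e" if "u \<in> L" for u
  proof -
    have "norm (c * f u - c * p u) = norm c * norm (f u - p u)"
      by (metis norm_mult right_diff_distrib)
    also have "\<dots> \<le> norm c * (e / (norm c + 1))"
      using p that by (intro mult_left_mono) (auto simp: less_imp_le)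
    also have "\<dots> < e" using e
      by (smt (verit, best) divide_less_eq mult.commute norm_ge_zero mult_strict_left_mono times_divide_eq_right)
    finally show ?thesis .
  qed
  thus "\<exists>q. q holomorphic_on UNIV \<and> (\<forall>u\<in>L. norm (c * f u - q u) < e)"
    using p by (intro exI[of _ "\<lambda>u. c * p u"]) (auto intro!: holomorphic_intros)
qed

lemma entire_approx_power:
  assumes f: "entire_approx L f" and B: "\<And>u. u \<in> L \<Longrightarrow> norm (f u) \<le> B"
  shows "entire_approx L (\<lambda>u. f u ^ n)"
proof (induction n)
  case 0
  show ?case by (auto intro!: entire_approx_holomorphic holomorphic_intros)
next
  case (Suc n)
  have "norm (f u ^ n) \<le> max 1 \<bar>B\<bar> ^ Suc n \<and> norm (f u) \<le> max 1 \<bar>B\<bar> ^ Suc n" if "u \<in> L" for u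
  proof -
    have le: "norm (f u) \<le> max 1 \<bar>B\<bar>" using B[OF that] by auto
    have "norm (f u) ^ n \<le> max 1 \<bar>B\<bar> ^ n" using le by (intro power_mono) auto
    also have "\<dots> \<le> max 1 \<bar>B\<bar> ^ Suc n" by (intro power_increasing) auto
    finally show ?thesis using order_trans[OF le self_le_power[of "max 1 \<bar>B\<bar>" "Suc n"]]
      by (simp add: norm_power)
  qed
  hence "norm (f u ^ n) \<le> max 1 \<bar>B\<bar> ^ Suc n" "norm (f u) \<le> max 1 \<bar>B\<bar> ^ Suc n" if "u \<in> L" for u
    using that by auto
  from entire_approx_mult[OF f Suc this(2,1)] show ?case by simp
qed

lemma entire_approx_sum:
  assumes "finite I" "\<And>i. i \<in> I \<Longrightarrow> entire_approx L (f i)"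
  shows "entire_approx L (\<lambda>u. \<Sum>i\<in>I. f i u)"
  using assms
proof (induction I rule: finite_induct)
  case empty
  show ?case by (auto intro!: entire_approx_holomorphic)
qed (auto intro!: entire_approx_add)

lemma entire_approx_limit:
  assumes "\<And>e. e > 0 \<Longrightarrow> \<exists>g. entire_approx L g \<and> (\<forall>u\<in>L. norm (f u - g u) < e)"
  shows "entire_approx L f"
  unfolding entire_approx_def
proof (intro allI impI)
  fix e :: real assume "e > 0"
  then obtain g where g: "entire_approx L g" "\<forall>u\<in>L. norm (f u - g u) < e/2"
    using assms by (meson half_gt_zero)
  then obtain p where p: "p holomorphic_on UNIV" "\<forall>u\<in>L. norm (g u - p u) < e/2"
    using \<open>e > 0\<close> unfolding entire_approx_def by (meson half_gt_zero)
  have "norm (f u - p u) < e" if "u \<in> L" for u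
    using norm_triangle_half_l[of "f u" "g u" e "p u"] g p that by (simp add: norm_minus_commute)
  thus "\<exists>p. p holomorphic_on UNIV \<and> (\<forall>u\<in>L. norm (f u - p u) < e)" using p by blast
qed

section \<open>Pole pushing\<close>

lemma geometric_remainder:
  fixes x :: complex assumes "norm x \<le> 1/2"
  shows "norm (1 / (1 - x) - (\<Sum>k<n. x ^ k)) \<le> 2 * (1/2) ^ n"
proof -
  have x1: "x \<noteq> 1" using assms by auto
  have "1 / (1 - x) - (\<Sum>k<n. x ^ k) = x ^ n / (1 - x)"
    using x1 by (simp add: sum_gp_strict diff_divide_distrib)
  moreover have "norm (1 - x) \<ge> 1/2" using norm_triangle_ineq2[of 1 x] assms by simp
  moreover have "norm (x ^ n) \<le> (1/2) ^ n" using assms by (simp add: norm_power power_mono)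
  ultimately show ?thesis
    using frac_le[of "(1/2) ^ n" "norm (x ^ n)" "1/2" "norm (1 - x)"] by (simp add: norm_divide)
qed

text \<open>Expand \<open>1 / (u - \<zeta>)\<close> as a geometric series in
  \<open>(\<zeta> - \<zeta>0) / (u - \<zeta>0)\<close>, whose modulus on \<open>L\<close> is at most
  1/2. The partial sums are polynomials in \<open>1 / (u - \<zeta>0)\<close>, so approximability is
  inherited.\<close>

lemma entire_approx_pole_shift:
  assumes a: "entire_approx L (\<lambda>u. 1 / (u - \<zeta>0))" and d: "d > 0"
    and far: "\<And>u. u \<in> L \<Longrightarrow> 2 * d \<le> dist u \<zeta>0" and near: "dist \<zeta> \<zeta>0 \<le> d"
  shows "entire_approx L (\<lambda>u. 1 / (u - \<zeta>))"
proof (rule entire_approx_limit)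
  fix e :: real assume e: "e > 0"
  have "(\<lambda>n. (1 / d) * (1/2) ^ n :: real) \<longlonglongrightarrow> (1 / d) * 0"
    by (intro tendsto_intros LIMSEQ_power_zero) auto
  then obtain n where n: "(1 / d) * (1/2) ^ n < e"
    using order_tendstoD(2)[of _ "0::real" sequentially e] e
    by (auto simp: eventually_sequentially)
  define g where "g = (\<lambda>u. \<Sum>k<n. (\<zeta> - \<zeta>0) ^ k * (1 / (u - \<zeta>0)) ^ Suc k)"
  have nb: "norm (1 / (u - \<zeta>0)) \<le> 1 / (2 * d)" if "u \<in> L" for u
    using far[OF that] d by (simp add: norm_divide dist_norm frac_le)
  have "entire_approx L g"
    unfolding g_def by (intro entire_approx_sum entire_approx_cmult entire_approx_power[OF a nb]) auto
  moreover have "norm (1 / (u - \<zeta>) - g u) < e" if u: "u \<in> L" for u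
  proof -
    define y where "y = 1 / (u - \<zeta>0)"
    define x where "x = (\<zeta> - \<zeta>0) * y"
    have u0: "u \<noteq> \<zeta>0" using far[OF u] d by auto
    have "norm x \<le> d * (1 / (2 * d))" unfolding x_def y_def norm_mult
      using near nb[OF u] d by (intro mult_mono) (auto simp: dist_norm)
    hence x: "norm x \<le> 1/2" using d by simp
    have "u - \<zeta> = (u - \<zeta>0) * (1 - x)" using u0 by (simp add: x_def y_def field_simps)
    hence "1 / (u - \<zeta>) = y * (1 / (1 - x))" by (simp add: y_def)
    moreover have "g u = y * (\<Sum>k<n. x ^ k)"
      unfolding g_def x_def y_def[symmetric] sum_distrib_left
      by (intro sum.cong) (auto simp: power_mult_distrib)
    ultimately have "norm (1 / (u - \<zeta>) - g u) = norm y * norm (1 / (1 - x) - (\<Sum>k<n. x ^ k))"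
      by (metis norm_mult right_diff_distrib)
    also have "\<dots> \<le> (1 / (2 * d)) * (2 * (1/2) ^ n)"
      using nb[OF u] geometric_remainder[OF x, of n] d unfolding y_def by (intro mult_mono) auto
    also have "\<dots> < e" using n by simp
    finally show ?thesis .
  qed
  ultimately show "\<exists>g. entire_approx L g \<and> (\<forall>u\<in>L. norm (1 / (u - \<zeta>) - g u) < e)" by blast
qed

text \<open>A pole far away is harmless, because \<open>1 / (u - \<zeta>0)\<close> is then a power
  series in \<open>u\<close> converging uniformly on \<open>L\<close>. Approximability is locally
  constant in the position of the pole, and the connected complement of \<open>L\<close> carries it
  to \<open>\<zeta>\<close>.\<close>

lemma entire_approx_pole:
  assumes L: "compact L" "connected (- L)" and \<zeta>: "\<zeta> \<notin> L"
  shows "entire_approx L (\<lambda>u. 1 / (u - \<zeta>))"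
proof -
  obtain B where B: "B > 0" "\<And>u. u \<in> L \<Longrightarrow> norm u \<le> B"
    using compact_imp_bounded[OF L(1)] by (auto simp: bounded_pos)
  \<comment> \<open>Twice the bound of \<open>L\<close>, so that \<open>u / \<zeta>0\<close> has
    modulus at most 1/2 on \<open>L\<close>.\<close>
  define \<zeta>0 :: complex where "\<zeta>0 = of_real (2 * B)"
  have n0: "norm \<zeta>0 = 2 * B" using B by (simp add: \<zeta>0_def)
  have z0L: "\<zeta>0 \<in> - L" using B n0 by force
  have base: "entire_approx L (\<lambda>u. 1 / (u - \<zeta>0))"
  proof (rule entire_approx_limit)
    fix e :: real assume e: "e > 0"
    have "(\<lambda>n. (1 / B) * (1/2) ^ n :: real) \<longlonglongrightarrow> (1 / B) * 0"
      by (intro tendsto_intros LIMSEQ_power_zero) auto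
    then obtain n where n: "(1 / B) * (1/2) ^ n < e"
      using order_tendstoD(2)[of _ "0::real" sequentially e] e
      by (auto simp: eventually_sequentially)
    define g where "g = (\<lambda>u. (- 1 / \<zeta>0) * (\<Sum>k<n. (u / \<zeta>0) ^ k))"
    have z0: "\<zeta>0 \<noteq> 0" using n0 B by auto
    have "entire_approx L g" unfolding g_def using z0
      by (intro entire_approx_holomorphic holomorphic_intros) auto
    moreover have "norm (1 / (u - \<zeta>0) - g u) < e" if u: "u \<in> L" for u
    proof -
      define x where "x = u / \<zeta>0"
      have x: "norm x \<le> 1/2" using B u n0 by (simp add: x_def norm_divide field_simps)
      have "u - \<zeta>0 = (- \<zeta>0) * (1 - x)" using z0 by (simp add: x_def field_simps)
      hence "1 / (u - \<zeta>0) = (- 1 / \<zeta>0) * (1 / (1 - x))"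
        by (simp only: mult_minus_left minus_mult_left[symmetric] minus_divide_right[symmetric] minus_divide_left[symmetric] times_divide_times_eq mult_1)
      hence "norm (1 / (u - \<zeta>0) - g u) = norm (- 1 / \<zeta>0) * norm (1 / (1 - x) - (\<Sum>k<n. x ^ k))"
        unfolding g_def x_def[symmetric] by (metis norm_mult right_diff_distrib)
      also have "\<dots> \<le> (1 / (2 * B)) * (2 * (1/2) ^ n)"
        using n0 B geometric_remainder[OF x, of n] by (intro mult_mono) (auto simp: norm_divide)
      also have "\<dots> < e" using n by simp
      finally show ?thesis .
    qed
    ultimately show "\<exists>g. entire_approx L g \<and> (\<forall>u\<in>L. norm (1 / (u - \<zeta>0) - g u) < e)" by blast
  qed
  show ?thesis
  proof (rule connected_induction_simple[of "- L" \<zeta>0 \<zeta> "\<lambda>\<zeta>. entire_approx L (\<lambda>u. 1 / (u - \<zeta>))"])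
    fix a assume "a \<in> - L"
    then obtain r where r: "r > 0" "ball a r \<subseteq> - L"
      using compact_imp_closed[OF L(1)] by (meson open_Compl open_contains_ball)
    \<comment> \<open>Two points of \<open>T\<close> are less than \<open>r/4\<close> apart, and
      each is at distance at least \<open>7 * r/8\<close> from \<open>L\<close>; the shift lemma
      with \<open>d = r/4\<close> asks only for \<open>r/2\<close>.\<close>
    define T where "T = ball a (r/8)"
    have step: "entire_approx L (\<lambda>u. 1 / (u - y))"
      if xy: "x \<in> T" "y \<in> T" "entire_approx L (\<lambda>u. 1 / (u - x))" for x y
    proof (rule entire_approx_pole_shift[OF xy(3), where d = "r/4"])
      fix u assume "u \<in> L"
      hence "dist a u \<ge> r" using r by (metis ComplD in_mono mem_ball not_le)
      moreover have "dist a x < r/8" using xy by (simp add: T_def)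
      ultimately show "2 * (r/4) \<le> dist u x"
        using dist_triangle[of a u x] r by (simp add: dist_commute)
    next
      have "dist a x < r/8" "dist a y < r/8" using xy by (auto simp: T_def)
      thus "dist y x \<le> r/4" using dist_triangle[of y x a] by (simp add: dist_commute)
    qed (use r in auto)
    have "ball a (r/8) \<subseteq> ball a r" using r by (intro subset_ball) simp
    hence "T \<subseteq> - L" using r(2) unfolding T_def by (rule subset_trans)
    hence "openin (top_of_set (- L)) T" by (intro open_subset) (simp_all add: T_def)
    moreover have "a \<in> T" using r by (simp add: T_def)
    ultimately show "\<exists>T. openin (top_of_set (- L)) T \<and> a \<in> T \<and>
        (\<forall>x\<in>T. \<forall>y\<in>T. entire_approx L (\<lambda>u. 1 / (u - x)) \<longrightarrow> entire_approx L (\<lambda>u. 1 / (u - y)))"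
      using step by blast
  qed (use L z0L base \<zeta> in auto)
qed

section \<open>Cauchy integrals as limits of combinations of simple poles\<close>

lemma Riemann_sum_bound:
  fixes g :: "real \<Rightarrow> complex"
  assumes g: "continuous_on {0..1} g" and N: "N > 0" and e: "e \<ge> 0"
    and var: "\<And>s t. s \<in> {0..1} \<Longrightarrow> t \<in> {0..1} \<Longrightarrow> \<bar>s - t\<bar> \<le> 1 / real N \<Longrightarrow> norm (g s - g t) \<le> e"
  shows "norm (integral {0..1} g - (\<Sum>i<N. g (real i / real N) / of_nat N)) \<le> e"
proof -
  have "norm (integral {0..real n / real N} g - (\<Sum>i<n. g (real i / real N) / of_nat N)) \<le> real n * e / real N"
    if "n \<le> N" for n using that
  proof (induction n)
    case (Suc n)
    define a b where "a = real n / real N" and "b = real (Suc n) / real N"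
    have ab: "0 \<le> a" "a \<le> b" "b \<le> 1" "b - a = 1 / real N"
      using Suc.prems N by (auto simp: a_def b_def field_simps)
    have int: "g integrable_on {0..b}" "g integrable_on {a..b}"
      using ab by (auto intro!: integrable_continuous_real continuous_on_subset[OF g])
    have split: "integral {0..a} g + integral {a..b} g = integral {0..b} g"
      using ab int by (intro Henstock_Kurzweil_Integration.integral_combine) auto
    have "integral {a..b} g - g a / of_nat N = integral {a..b} (\<lambda>t. g t - g a)"
      using int ab by (subst integral_diff) (auto simp: scaleR_conv_of_real divide_inverse mult.commute)
    also have "norm \<dots> \<le> e * (b - a)"
    proof (rule integral_bound)
      show "continuous_on {a..b} (\<lambda>t. g t - g a)"
        using ab by (intro continuous_intros continuous_on_subset[OF g]) auto
      show "norm (g t - g a) \<le> e" if "t \<in> {a..b}" for t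
        using that ab by (intro var) auto
    qed (use ab in auto)
    finally have *: "norm (integral {a..b} g - g a / of_nat N) \<le> e / real N" using ab by simp
    have "integral {0..b} g - (\<Sum>i<Suc n. g (real i / real N) / of_nat N)
       = (integral {0..a} g - (\<Sum>i<n. g (real i / real N) / of_nat N)) + (integral {a..b} g - g a / of_nat N)"
      by (simp add: split[symmetric] a_def)
    also have "norm \<dots> \<le> real n * e / real N + e / real N"
      using Suc * by (intro norm_triangle_mono) (auto simp: a_def)
    finally show ?case by (simp add: b_def add_divide_distrib distrib_right add.commute)
  qed auto
  from this[of N] N show ?thesis by simp
qed

text \<open>Uniform continuity on the compact product makes the Riemann sums converge at a rate
  independent of \<open>u\<close>, so the integral is a uniform limit of finite combinations of the
  \<open>\<phi> t\<close>.\<close>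

lemma entire_approx_integral:
  fixes \<phi> :: "real \<Rightarrow> complex \<Rightarrow> complex"
  assumes cont: "continuous_on ({0..1} \<times> L) (\<lambda>(t,u). \<phi> t u)" and L: "compact L"
    and ap: "\<And>t. t \<in> {0..1} \<Longrightarrow> entire_approx L (\<phi> t)"
  shows "entire_approx L (\<lambda>u. integral {0..1} (\<lambda>t. \<phi> t u))"
proof (rule entire_approx_limit)
  fix e :: real assume e: "e > 0"
  have "uniformly_continuous_on ({0..1} \<times> L) (\<lambda>(t,u). \<phi> t u)"
    using cont L by (intro compact_uniformly_continuous compact_Times) auto
  then obtain d where d: "d > 0" and dd: "\<And>x y. x \<in> {0..1} \<times> L \<Longrightarrow> y \<in> {0..1} \<times> L \<Longrightarrow>
      dist y x < d \<Longrightarrow> dist ((\<lambda>(t,u). \<phi> t u) y) ((\<lambda>(t,u). \<phi> t u) x) < e/2"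
    using e unfolding uniformly_continuous_on_def by (meson half_gt_zero)
  obtain N where N: "N > 0" "1 / real N < d"
    using d real_arch_inverse[of d] by (auto simp: inverse_eq_divide)
  define g where "g = (\<lambda>u. \<Sum>i<N. (1 / of_nat N) * \<phi> (real i / real N) u)"
  have "entire_approx L g" unfolding g_def using N
    by (intro entire_approx_sum entire_approx_cmult ap) auto
  moreover have "norm (integral {0..1} (\<lambda>t. \<phi> t u) - g u) < e" if u: "u \<in> L" for u
  proof -
    have "continuous_on {0..1} ((\<lambda>(t,u). \<phi> t u) \<circ> (\<lambda>t. (t,u)))"
      using u by (intro continuous_on_compose continuous_on_subset[OF cont] continuous_intros) auto
    hence "continuous_on {0..1} (\<lambda>t. \<phi> t u)" by (simp add: o_def)
    moreover have "norm (\<phi> s u - \<phi> t u) \<le> e/2"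
      if "s \<in> {0..1}" "t \<in> {0..1}" "\<bar>s - t\<bar> \<le> 1 / real N" for s t
      using dd[of "(t,u)" "(s,u)"] that u N by (auto simp: dist_Pair_Pair dist_norm)
    ultimately have "norm (integral {0..1} (\<lambda>t. \<phi> t u) - (\<Sum>i<N. \<phi> (real i / real N) u / of_nat N)) \<le> e/2"
      using N e by (intro Riemann_sum_bound) auto
    thus ?thesis using e by (simp add: g_def)
  qed
  ultimately show "\<exists>g. entire_approx L g \<and> (\<forall>u\<in>L. norm (integral {0..1} (\<lambda>t. \<phi> t u) - g u) < e)"
    by blast
qed

lemma disc_image_compl_connected:
  assumes "continuous_on (cball 0 \<sigma>) \<Theta>" "inj_on \<Theta> (cball (0::complex) \<sigma>)"
  shows "compact (\<Theta> ` cball 0 \<sigma>)" "connected (- (\<Theta> ` cball 0 \<sigma>) :: complex set)"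
proof -
  show c: "compact (\<Theta> ` cball 0 \<sigma>)" using assms by (intro compact_continuous_image) auto
  have "cball (0::complex) \<sigma> homeomorphic \<Theta> ` cball 0 \<sigma>"
    using homeomorphic_compact[OF compact_cball assms(1) refl assms(2)] .
  hence "\<Theta> ` cball 0 \<sigma> homeomorphic cball (0::complex) \<sigma>" by (rule homeomorphic_sym[THEN iffD1])
  thus "connected (- (\<Theta> ` cball 0 \<sigma>) :: complex set)"
    by (rule connected_complement_homeomorphic_convex_compact) auto
qed

text \<open>This is Cauchy's formula for \<open>k\<close> composed with the inverse of
  \<open>\<Theta>\<close>, pulled back to the disc so that no winding number of the image curve is
  needed. The quotient \<open>(\<Theta> v - \<Theta> w) / (v - w)\<close> extends to a zero-free
  holomorphic \<open>D\<close>, and the integrand is \<open>m v / (v - w)\<close> with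
  \<open>m w = k w\<close>. As a function of \<open>\<Theta> w\<close> it has a simple pole at
  \<open>\<Theta> v\<close>.\<close>

lemma Cauchy_formula_univalent:
  assumes \<Theta>: "\<Theta> holomorphic_on ball 0 1" "inj_on \<Theta> (ball 0 1)"
    and k: "k holomorphic_on ball 0 1" and w: "norm w < \<tau>" and \<tau>: "\<tau> < 1"
  shows "((\<lambda>v. k v * deriv \<Theta> v / (\<Theta> v - \<Theta> w)) has_contour_integral
            (2 * of_real pi * \<i> * k w)) (circlepath 0 \<tau>)"
proof -
  define D where "D = (\<lambda>z. if z = w then deriv \<Theta> w else (\<Theta> z - \<Theta> w) / (z - w))"
  have D: "D holomorphic_on ball 0 1" unfolding D_def by (rule pole_lemma_open) (use \<Theta> in auto)
  have wb: "w \<in> ball 0 1" using w \<tau> by auto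
  have Dnz: "D z \<noteq> 0" if "z \<in> ball 0 1" for z
    using that wb \<Theta> holomorphic_injective_imp_regular[OF \<Theta>(1) open_ball \<Theta>(2) wb]
    by (auto simp: D_def inj_on_def)
  define m where "m = (\<lambda>v. k v * deriv \<Theta> v / D v)"
  have m: "m holomorphic_on ball 0 1" unfolding m_def
    by (intro holomorphic_intros k D holomorphic_deriv \<Theta> Dnz) auto
  have mw: "m w = k w" using Dnz[OF wb] by (auto simp: m_def D_def)
  have "((\<lambda>u. m u / (u - w)) has_contour_integral (2 * of_real pi * \<i> * m w)) (circlepath 0 \<tau>)"
    using w \<tau> m
    by (intro Cauchy_integral_circlepath)
       (auto intro!: holomorphic_on_imp_continuous_on elim!: holomorphic_on_subset)
  moreover have "m u / (u - w) = k u * deriv \<Theta> u / (\<Theta> u - \<Theta> w)" if "u \<in> path_image (circlepath 0 \<tau>)" for u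
  proof -
    have "\<tau> > 0" using w norm_ge_zero[of w] by linarith
    hence "norm u = \<tau>" using that by (auto simp: path_image_circlepath)
    hence "u \<noteq> w" using w by auto
    thus ?thesis by (simp add: m_def D_def)
  qed
  ultimately show ?thesis unfolding mw by (rule has_contour_integral_eq)
qed

text \<open>Runge's theorem in the form used later. The Cauchy integral over a circle of radius
  between \<open>\<sigma>\<close> and 1 is a superposition of simple poles on the image of that
  circle, which avoids \<open>L\<close> by injectivity.\<close>

lemma entire_approx_disc_image:
  assumes \<Theta>: "\<Theta> holomorphic_on ball 0 1" "inj_on \<Theta> (ball 0 1)"
    and k: "k holomorphic_on ball 0 1" and \<sigma>: "0 < \<sigma>" "\<sigma> < 1" and e: "e > 0"
  obtains p where "p holomorphic_on UNIV" "\<And>v. v \<in> cball 0 \<sigma> \<Longrightarrow> norm (k v - p (\<Theta> v)) < e"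
proof -
  define L where "L = \<Theta> ` cball 0 \<sigma>"
  define \<tau> where "\<tau> = (\<sigma> + 1) / 2"
  have \<tau>: "\<sigma> < \<tau>" "\<tau> < 1" "0 < \<tau>" using \<sigma> by (auto simp: \<tau>_def)
  have sub: "cball 0 \<sigma> \<subseteq> ball (0::complex) 1" using \<sigma> by auto
  have contT: "continuous_on (ball 0 1) \<Theta>" using \<Theta> holomorphic_on_imp_continuous_on by blast
  have L: "compact L" "connected (- L)"
    unfolding L_def using disc_image_compl_connected continuous_on_subset[OF contT sub] inj_on_subset[OF \<Theta>(2) sub]
    by blast+
  define c where "c = circlepath (0::complex) \<tau>"
  have cnorm: "norm (c t) = \<tau>" for t using \<tau> by (simp add: c_def circlepath norm_mult)
  have cb: "c t \<in> ball 0 1" for t using \<tau> cnorm[of t] by simp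
  have cL: "\<Theta> (c t) \<notin> L" for t
  proof
    assume "\<Theta> (c t) \<in> L"
    then obtain v where "v \<in> cball 0 \<sigma>" "\<Theta> (c t) = \<Theta> v" unfolding L_def by blast
    hence "c t = v" using \<Theta>(2) cb[of t] sub by (meson inj_onD subsetD)
    thus False using \<open>v \<in> cball 0 \<sigma>\<close> cnorm[of t] \<tau> by simp
  qed
  \<comment> \<open>\<open>A\<close> collects the factors of the integrand that do not involve
    \<open>u\<close>, including the derivative of the circle and \<open>1 / (2 * pi * \<i>)\<close>.
    The minus sign in \<open>\<phi>\<close> comes from writing the pole as
    \<open>1 / (u - \<Theta> (c t))\<close>.\<close>
  define A where "A = (\<lambda>t. k (c t) * deriv \<Theta> (c t) * (2 * of_real pi * \<i> * \<tau> * exp (2 * of_real pi * \<i> * t)) / (2 * of_real pi * \<i>))"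
  define \<phi> where "\<phi> = (\<lambda>t u. - A t * (1 / (u - \<Theta> (c t))))"
  have contc: "continuous_on UNIV c" unfolding c_def circlepath by (intro continuous_intros)
  have comp: "continuous_on S (\<lambda>t. f (c t))" if "f holomorphic_on ball 0 1" for f S
    using cb by (intro continuous_on_compose2[OF holomorphic_on_imp_continuous_on[OF that] continuous_on_subset[OF contc]]) auto
  have "continuous_on ({0..1} \<times> L) (\<lambda>(t,u). \<phi> t u)"
  proof -
    have "continuous_on S A" for S unfolding A_def
      by (intro continuous_intros comp k holomorphic_deriv \<Theta>) auto
    hence "continuous_on ({0..1} \<times> L) (\<lambda>x. A (fst x))"
      by (rule continuous_on_compose2[of UNIV]) (auto intro!: continuous_intros)
    moreover have "continuous_on ({0..1} \<times> L) (\<lambda>x. \<Theta> (c (fst x)))"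
      by (rule continuous_on_compose2[OF comp[OF \<Theta>(1), of UNIV]]) (auto intro!: continuous_intros)
    moreover have "\<forall>x\<in>{0..1} \<times> L. snd x - \<Theta> (c (fst x)) \<noteq> 0"
    proof (intro ballI notI)
      fix x assume "x \<in> {0..1::real} \<times> L" "snd x - \<Theta> (c (fst x)) = 0"
      thus False using cL[of "fst x"] by (simp add: mem_Times_iff)
    qed
    ultimately show ?thesis unfolding \<phi>_def case_prod_beta by (intro continuous_intros)
  qed
  moreover have "entire_approx L (\<phi> t)" for t unfolding \<phi>_def
    by (intro entire_approx_cmult entire_approx_pole L cL)
  ultimately have ap: "entire_approx L (\<lambda>u. integral {0..1} (\<lambda>t. \<phi> t u))"
    using L by (intro entire_approx_integral) auto
  have "integral {0..1} (\<lambda>t. \<phi> t (\<Theta> w)) = k w" if w: "w \<in> cball 0 \<sigma>" for w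
  proof -
    have "norm w < \<tau>" using w \<tau> by simp
    from Cauchy_formula_univalent[OF \<Theta> k this \<tau>(2)]
    have "((\<lambda>t. k (c t) * deriv \<Theta> (c t) / (\<Theta> (c t) - \<Theta> w) * vector_derivative c (at t within {0..1}))
        has_integral (2 * of_real pi * \<i> * k w)) {0..1}"
      unfolding has_contour_integral_def c_def .
    hence "((\<lambda>t. k (c t) * deriv \<Theta> (c t) / (\<Theta> (c t) - \<Theta> w) * vector_derivative c (at t within {0..1}) / (2 * of_real pi * \<i>))
        has_integral (2 * of_real pi * \<i> * k w) / (2 * of_real pi * \<i>)) {0..1}"
      by (rule has_integral_divide)
    hence "((\<lambda>t. \<phi> t (\<Theta> w)) has_integral (2 * of_real pi * \<i> * k w) / (2 * of_real pi * \<i>)) {0..1}"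
    proof (rule has_integral_eq[rotated])
      fix t :: real assume t: "t \<in> {0..1}"
      have "vector_derivative c (at t within {0..1}) = 2 * of_real pi * \<i> * \<tau> * exp (2 * of_real pi * \<i> * t)"
        unfolding c_def using t by (simp add: vector_derivative_circlepath01)
      moreover have "\<Theta> w - \<Theta> (c t) \<noteq> 0"
        using cL[of t] w unfolding L_def by (metis imageI right_minus_eq)
      ultimately show "k (c t) * deriv \<Theta> (c t) / (\<Theta> (c t) - \<Theta> w) * vector_derivative c (at t within {0..1}) / (2 * of_real pi * \<i>) = \<phi> t (\<Theta> w)"
        unfolding \<phi>_def A_def by (simp add: divide_simps) (simp add: algebra_simps)
    qed
    thus ?thesis by (simp add: integral_unique)
  qed
  moreover obtain p where "p holomorphic_on UNIV" "\<forall>u\<in>L. norm (integral {0..1} (\<lambda>t. \<phi> t u) - p u) < e"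
    using ap e unfolding entire_approx_def by blast
  ultimately show ?thesis using that[of p] by (auto simp: L_def)
qed

text \<open>If \<open>p\<close> approximates \<open>1 / (u - b)\<close> on \<open>L\<close>, then
  \<open>1 - (u - b) * p u\<close> is small on \<open>L\<close> and equals 1 at
  \<open>b\<close>.\<close>

lemma entire_peak:
  assumes L: "compact L" "connected (- L)" and b: "b \<notin> L" and e: "e > 0"
  obtains g where "g holomorphic_on UNIV" "g b = c" "\<And>u. u \<in> L \<Longrightarrow> norm (g u) < e"
proof -
  obtain B where B: "B > 0" "\<And>u. u \<in> L \<Longrightarrow> norm u \<le> B"
    using compact_imp_bounded[OF L(1)] by (auto simp: bounded_pos)
  define d where "d = e / ((norm c + 1) * (B + norm b + 1))"
  have d: "d > 0" using e B by (auto simp: d_def intro!: divide_pos_pos mult_pos_pos add_pos_nonneg add_nonneg_pos)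
  obtain p where p: "p holomorphic_on UNIV" "\<And>u. u \<in> L \<Longrightarrow> norm (1 / (u - b) - p u) < d"
    using entire_approx_pole[OF L b] d unfolding entire_approx_def by blast
  define g where "g = (\<lambda>u. c * (1 - (u - b) * p u))"
  have "g holomorphic_on UNIV" unfolding g_def by (intro holomorphic_intros p)
  moreover have "norm (g u) < e" if u: "u \<in> L" for u
  proof -
    have "u \<noteq> b" using u b by auto
    hence "g u = c * ((u - b) * (1 / (u - b) - p u))" by (simp add: g_def algebra_simps)
    hence "norm (g u) = norm c * (norm (u - b) * norm (1 / (u - b) - p u))" by (simp add: norm_mult)
    also have "\<dots> \<le> norm c * ((B + norm b) * d)"
      using p(2)[OF u] B(2)[OF u] norm_triangle_ineq4[of u b] B(1)
      by (intro mult_left_mono mult_mono) auto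
    also have "\<dots> < (norm c + 1) * ((B + norm b + 1) * d)"
      using d B by (intro mult_strict_mono mult_strict_right_mono) (auto intro!: mult_pos_pos add_nonneg_pos mult_nonneg_nonneg)
    also have "\<dots> = (norm c + 1) * (B + norm b + 1) * d" by (simp only: mult.assoc)
    also have "\<dots> = e"
    proof -
      have "(norm c + 1) * (B + norm b + 1) > 0" using B by (intro mult_pos_pos add_nonneg_pos) auto
      moreover have "M * (e / M) = e" if "M > 0" for M :: real using that by simp
      ultimately show ?thesis unfolding d_def by blast
    qed
    finally show ?thesis .
  qed
  ultimately show ?thesis using that[of g] by (simp add: g_def)
qed

subsection \<open>Locally univalent entire functions with small zeros\<close>

text \<open>The difference \<open>f z - z\<close> is \<open>\<kappa>\<close>-Lipschitz on the convex
  set, so it cannot cancel \<open>x - y\<close>.\<close>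

lemma near_identity_inj_on:
  fixes f :: "complex \<Rightarrow> complex"
  assumes S: "convex S" and f: "\<And>z. z \<in> S \<Longrightarrow> (f has_field_derivative f' z) (at z within S)"
    and near: "\<And>z. z \<in> S \<Longrightarrow> norm (f' z - 1) \<le> \<kappa>" and \<kappa>: "\<kappa> < 1"
  shows "inj_on f S"
proof (rule inj_onI)
  fix x y assume xy: "x \<in> S" "y \<in> S" "f x = f y"
  have "norm ((f x - x) - (f y - y)) \<le> \<kappa> * norm (x - y)"
    by (rule field_differentiable_bound[OF S _ near xy(1,2)]) (auto intro!: derivative_eq_intros f)
  hence "norm (x - y) \<le> \<kappa> * norm (x - y)" using xy(3) by (simp add: norm_minus_commute)
  hence "(1 - \<kappa>) * norm (x - y) \<le> 0" by (simp add: algebra_simps)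
  thus "x = y" using \<kappa> by (simp add: mult_le_0_iff)
qed

text \<open>Solutions of \<open>f z = y\<close> are the fixed points of
  \<open>z \<mapsto> y - (f z - z)\<close>, which maps the closed ball into itself; Brouwer
  applies.\<close>

lemma near_identity_onto:
  fixes f :: "complex \<Rightarrow> complex"
  assumes f: "continuous_on (cball 0 r) f" and near: "\<And>z. z \<in> cball 0 r \<Longrightarrow> norm (f z - z) \<le> d"
    and r: "r > 0" and y: "norm y + d \<le> r"
  obtains z where "z \<in> cball 0 r" "f z = y" "norm z \<le> norm y + d"
proof -
  obtain z :: complex where z: "z \<in> cball 0 r" "y - (f z - z) = z"
  proof (rule brouwer_ball[OF r, of 0 "\<lambda>z. y - (f z - z)"])
    show "continuous_on (cball 0 r) (\<lambda>z. y - (f z - z))" by (intro continuous_intros f)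
    show "(\<lambda>z. y - (f z - z)) \<in> cball 0 r \<rightarrow> cball 0 r"
    proof
      fix z :: complex assume "z \<in> cball 0 r"
      thus "y - (f z - z) \<in> cball 0 r"
        using near[of z] y norm_triangle_ineq4[of y "f z - z"] by simp
    qed
  qed auto
  have "norm z = norm (y - (f z - z))" by (simp only: z(2))
  also have "\<dots> \<le> norm y + d" using near[OF z(1)] norm_triangle_ineq4[of y "f z - z"] by linarith
  finally show ?thesis using that[of z] z by (simp add: algebra_simps)
qed

text \<open>Otherwise Cauchy's estimate on the circle of radius \<open>d\<close> would bound the
  derivative at \<open>b\<close> by \<open>M / d\<close>.\<close>

lemma entire_large_value:
  assumes f: "f holomorphic_on UNIV" and d: "d > 0" and big: "norm (deriv f b) > M / d"
  shows "\<exists>u. dist b u \<le> d \<and> norm (f u) > M"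
proof (rule ccontr)
  assume "\<not> ?thesis"
  hence "norm (f x) \<le> M" if "norm (b - x) = d" for x
    using that by (metis dist_norm linorder_not_less order_refl)
  hence "norm ((deriv ^^ 1) f b) \<le> fact 1 * M / d ^ 1"
    using d f by (intro Cauchy_inequality)
      (auto intro: holomorphic_on_subset holomorphic_on_imp_continuous_on)
  thus False using big by simp
qed

text \<open>By Runge's theorem the logarithm of the derivative of the inverse of \<open>\<Theta>\<close> is approximated
  by an entire function \<open>h\<close> which is huge at \<open>b0\<close>. A primitive \<open>F1\<close> of \<open>exp \<circ> h\<close> then nearly
  inverts \<open>\<Theta>\<close> and takes some huge value \<open>F1 u\<close> with \<open>u\<close> near \<open>b0\<close>; composing with
  \<open>x \<mapsto> B (exp (x / B) - 1)\<close>, \<open>2 \<pi> \<i> B = F1 u\<close>, which is close to the identity on bounded sets,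
  turns \<open>u\<close> into a zero.\<close>

lemma locally_univalent_with_small_zero:
  assumes \<Theta>: "\<Theta> holomorphic_on ball 0 1" "inj_on \<Theta> (ball 0 1)" "\<Theta> 0 = 0"
    and \<rho>: "0 < \<rho>" "\<rho> < 1" and b0: "b0 \<notin> \<Theta> ` ball 0 1" "norm b0 < \<eta>"
  obtains F T \<rho>' b where "F holomorphic_on UNIV" "F 0 = 0" "\<And>z. deriv F z \<noteq> 0"
    "F b = 0" "b \<noteq> 0" "norm b < \<eta>" "\<rho> < \<rho>'" "T holomorphic_on ball 0 \<rho>'" "inj_on T (ball 0 \<rho>')"
    "T 0 = 0" "T ` ball 0 \<rho>' \<subseteq> \<Theta> ` ball 0 1" "\<Theta> ` ball 0 \<rho> \<subseteq> T ` ball 0 \<rho>'"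
    "\<And>v. v \<in> ball 0 \<rho>' \<Longrightarrow> F (T v) = v"
proof -
  \<comment> \<open>The radii \<open>\<rho> < \<rho>' < \<sigma> < 1\<close> are separated by more
    than \<open>\<kappa>\<close>, which will bound the displacement of \<open>H\<close>: thus
    \<open>H\<close> maps the ball of radius \<open>\<rho>\<close> into that of radius
    \<open>\<rho>'\<close>, and covers the latter from inside the ball of radius
    \<open>\<sigma>\<close>.\<close>
  define \<sigma> where "\<sigma> = (\<rho> + 1) / 2"
  define \<rho>' where "\<rho>' = (\<rho> + \<sigma>) / 2"
  define \<kappa> where "\<kappa> = (\<sigma> - \<rho>') / 2"
  have \<sigma>: "0 < \<sigma>" "\<sigma> < 1" "\<rho> < \<rho>'" "\<rho>' < \<sigma>" using \<rho> by (auto simp: \<sigma>_def \<rho>'_def)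
  have \<kappa>: "0 < \<kappa>" "\<kappa> < 1" "\<rho> + \<kappa> < \<rho>'" "\<rho>' + \<kappa> < \<sigma>" using \<rho> by (auto simp: \<kappa>_def \<sigma>_def \<rho>'_def field_simps)
  have sub: "cball 0 \<sigma> \<subseteq> ball (0::complex) 1" using \<sigma> by auto
  obtain \<epsilon>0 where \<epsilon>0: "\<epsilon>0 > 0" "\<And>x::complex. norm x < \<epsilon>0 \<Longrightarrow> norm (exp x - 1) < \<kappa>"
  proof -
    have "isCont exp (0::complex)" by simp
    thus ?thesis using \<kappa>(1) that unfolding continuous_at_eps_delta by (auto simp: dist_norm)
  qed
  define \<epsilon> where "\<epsilon> = min \<epsilon>0 1"
  have \<epsilon>: "\<epsilon> > 0" "\<epsilon> \<le> 1" "\<And>x::complex. norm x < \<epsilon> \<Longrightarrow> norm (exp x - 1) < \<kappa>"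
    using \<epsilon>0 by (auto simp: \<epsilon>_def)
  have dT: "deriv \<Theta> v \<noteq> 0" if "v \<in> ball 0 1" for v
    using holomorphic_injective_imp_regular[OF \<Theta>(1) open_ball \<Theta>(2) that] .
  obtain k where k: "k holomorphic_on ball 0 1" "\<And>v. v \<in> ball 0 1 \<Longrightarrow> exp (k v) = deriv \<Theta> v"
    using holomorphic_logarithm_exists[of "ball 0 1" "deriv \<Theta>" 0] dT \<Theta>
    by (auto intro: holomorphic_deriv)
  obtain p where p: "p holomorphic_on UNIV" "\<And>v. v \<in> cball 0 \<sigma> \<Longrightarrow> norm (- k v - p (\<Theta> v)) < \<epsilon>/4"
    using entire_approx_disc_image[OF \<Theta>(1,2) holomorphic_on_minus[OF k(1)] \<sigma>(1,2), of "\<epsilon>/4"] \<epsilon>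
    by auto
  define L where "L = \<Theta> ` cball 0 \<sigma>"
  have contT: "continuous_on (ball 0 1) \<Theta>" using \<Theta> holomorphic_on_imp_continuous_on by blast
  have L: "compact L" "connected (- L)"
    unfolding L_def using disc_image_compl_connected continuous_on_subset[OF contT sub] inj_on_subset[OF \<Theta>(2) sub]
    by blast+
  have bL: "b0 \<notin> L" using b0 sub by (auto simp: L_def)
  \<comment> \<open>With \<open>norm (F1 u) > M\<close> the constant \<open>B\<close> below has
    modulus above \<open>8 / \<epsilon>\<close>. As \<open>F1\<close> is bounded by 2 on
    \<open>L\<close>, the correction \<open>F1 / B\<close> is at most \<open>\<epsilon> / 4\<close>
    there.\<close>
  define M where "M = 16 * pi / \<epsilon>"
  define d where "d = (\<eta> - norm b0) / 2"
  have M: "M > 0" and d: "d > 0" using \<epsilon> b0 by (auto simp: M_def d_def)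
  \<comment> \<open>Chosen so that \<open>exp N\<close>, the modulus of the derivative of
    \<open>F1\<close> at \<open>b0\<close>, exceeds \<open>M / d\<close>. The peak function
    \<open>g\<close> lifts \<open>p\<close> to the value \<open>N\<close> at \<open>b0\<close> and
    hardly changes it on \<open>L\<close>.\<close>
  define N where "N = ln (M / d + 1)"
  obtain g where g: "g holomorphic_on UNIV" "g b0 = of_real N - p b0" "\<And>u. u \<in> L \<Longrightarrow> norm (g u) < \<epsilon>/4"
    using entire_peak[OF L bL, of "\<epsilon>/4" "of_real N - p b0"] \<epsilon> by auto
  define h where "h = (\<lambda>u. p u + g u)"
  have h: "h holomorphic_on UNIV" "h b0 = of_real N" using p g by (auto simp: h_def intro!: holomorphic_intros)
  have hk: "norm (h (\<Theta> v) + k v) < \<epsilon>/2" if "v \<in> cball 0 \<sigma>" for v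
  proof -
    have v: "\<Theta> v \<in> L" using that by (auto simp: L_def)
    have eq: "h (\<Theta> v) + k v = g (\<Theta> v) - (- k v - p (\<Theta> v))" by (simp add: h_def)
    show ?thesis unfolding eq
      using norm_triangle_ineq4[of "g (\<Theta> v)" "- k v - p (\<Theta> v)"] g(3)[OF v] p(2)[OF that] by linarith
  qed
  obtain F0 where F0: "\<And>x. (F0 has_field_derivative exp (h x)) (at x)"
    using holomorphic_convex_primitive'[of UNIV "\<lambda>x. exp (h x)"] h
    by (auto intro!: holomorphic_intros)
  define F1 where "F1 = (\<lambda>x. F0 x - F0 0)"
  have F1: "(F1 has_field_derivative exp (h x)) (at x)" for x
    unfolding F1_def by (auto intro!: derivative_eq_intros F0)
  have F1h: "F1 holomorphic_on UNIV" using F1 by (auto simp: holomorphic_on_open)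
  have "norm (deriv F1 b0) = exp N" using DERIV_imp_deriv[OF F1, of b0] h by simp
  moreover have "exp N > M / d" using M d by (simp add: N_def add_pos_pos)
  ultimately obtain u where u: "dist b0 u \<le> d" "norm (F1 u) > M"
    using entire_large_value[OF F1h d, where b = b0 and M = M] by auto
  define B where "B = F1 u / (2 * of_real pi * \<i>)"
  have B: "norm B > 8 / \<epsilon>" using u(2) \<epsilon> by (simp add: B_def norm_divide norm_mult M_def field_simps)
  hence B0: "B \<noteq> 0" using \<epsilon> by auto
  define F where "F = (\<lambda>x. B * (exp (F1 x / B) - 1))"
  have F: "(F has_field_derivative exp (F1 x / B) * exp (h x)) (at x)" for x
    unfolding F_def using B0 by (auto intro!: derivative_eq_intros F1)
  define H where "H = (\<lambda>v. F (\<Theta> v))"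
  define H' where "H' = (\<lambda>v. exp (F1 (\<Theta> v) / B) * exp (h (\<Theta> v)) * deriv \<Theta> v)"
  have Th: "(\<Theta> has_field_derivative deriv \<Theta> v) (at v)" if "v \<in> ball 0 1" for v
    using \<Theta>(1) that holomorphic_derivI open_ball by blast
  have Hd: "(H has_field_derivative H' v) (at v)" if "v \<in> ball 0 1" for v
    unfolding H_def H'_def using DERIV_chain2[OF F Th[OF that]] .
  \<comment> \<open>The derivative of \<open>F1 (\<Theta> v)\<close> is
    \<open>exp (h (\<Theta> v) + k v)\<close>, which is within \<open>\<kappa> < 1\<close> of
    1.\<close>
  have F1b: "norm (F1 (\<Theta> v)) \<le> 2" if v: "v \<in> cball 0 \<sigma>" for v
  proof -
    have "norm (F1 (\<Theta> v) - F1 (\<Theta> 0)) \<le> 2 * norm (v - 0)"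
    proof (rule field_differentiable_bound[of "cball 0 \<sigma>" "\<lambda>v. F1 (\<Theta> v)" "\<lambda>v. exp (h (\<Theta> v)) * deriv \<Theta> v"])
      fix z :: complex assume z: "z \<in> cball 0 \<sigma>"
      hence zb: "z \<in> ball 0 1" using sub by blast
      show "((\<lambda>v. F1 (\<Theta> v)) has_field_derivative exp (h (\<Theta> z)) * deriv \<Theta> z) (at z within cball 0 \<sigma>)"
        by (rule has_field_derivative_at_within[OF DERIV_chain2[OF F1 Th[OF zb]]])
      have "exp (h (\<Theta> z)) * deriv \<Theta> z = exp (h (\<Theta> z) + k z)" using k(2)[OF zb] by (simp add: exp_add)
      moreover have "norm (exp (h (\<Theta> z) + k z) - 1) < \<kappa>" using hk[OF z] \<epsilon> by (intro \<epsilon>(3)) auto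
      ultimately show "norm (exp (h (\<Theta> z)) * deriv \<Theta> z) \<le> 2"
        using \<kappa>(2) norm_triangle_ineq2[of "exp (h (\<Theta> z) + k z)" 1] by simp
    qed (use v \<sigma> in auto)
    also have "\<dots> \<le> 2" using v \<sigma> by simp
    finally show ?thesis by (simp add: \<Theta> F1_def)
  qed
  \<comment> \<open>\<open>H'\<close> is the exponential of \<open>F1 / B\<close> plus
    \<open>h + k\<close>, bounded by \<open>\<epsilon> / 4\<close> and
    \<open>\<epsilon> / 2\<close>.\<close>
  have H1: "norm (H' v - 1) \<le> \<kappa>" if v: "v \<in> cball 0 \<sigma>" for v
  proof -
    have vb: "v \<in> ball 0 1" using v sub by blast
    have "H' v = exp (F1 (\<Theta> v) / B + (h (\<Theta> v) + k v))"
      using k(2)[OF vb] by (simp add: H'_def exp_add)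
    moreover have "norm (F1 (\<Theta> v) / B) \<le> 2 / (8 / \<epsilon>)"
      using F1b[OF v] B \<epsilon> unfolding norm_divide by (intro frac_le) auto
    hence "norm (F1 (\<Theta> v) / B + (h (\<Theta> v) + k v)) < \<epsilon>"
      using hk[OF v] norm_triangle_ineq[of "F1 (\<Theta> v) / B" "h (\<Theta> v) + k v"] \<epsilon>(1) by simp
    ultimately show ?thesis using \<epsilon>(3) by (simp add: less_imp_le)
  qed
  have H0: "H 0 = 0" by (simp add: H_def F_def F1_def \<Theta>)
  have Hnear: "norm (H v - v) \<le> \<kappa>" if v: "v \<in> cball 0 \<sigma>" for v
  proof -
    have "norm ((H v - v) - (H 0 - 0)) \<le> \<kappa> * norm (v - 0)"
    proof (rule field_differentiable_bound[of "cball 0 \<sigma>" "\<lambda>v. H v - v" "\<lambda>v. H' v - 1"])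
      fix z :: complex assume z: "z \<in> cball 0 \<sigma>"
      hence zb: "z \<in> ball 0 1" using sub by blast
      show "((\<lambda>v. H v - v) has_field_derivative H' z - 1) (at z within cball 0 \<sigma>)"
        by (auto intro!: derivative_eq_intros has_field_derivative_at_within[OF Hd[OF zb]])
    qed (use v \<sigma> H1 in auto)
    also have "\<dots> \<le> \<kappa> * 1" using v \<sigma> \<kappa> by (intro mult_left_mono) auto
    finally show ?thesis by (simp add: H0)
  qed
  have Hh: "H holomorphic_on ball 0 \<sigma>"
    unfolding holomorphic_on_open[OF open_ball]
  proof
    fix x :: complex assume "x \<in> ball 0 \<sigma>"
    hence "x \<in> ball 0 1" using \<sigma> by simp
    thus "\<exists>f'. (H has_field_derivative f') (at x)" using Hd by blast
  qed
  have Hinj: "inj_on H (ball 0 \<sigma>)"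
  proof (rule near_identity_inj_on[where f' = H' and \<kappa> = \<kappa>])
    fix z :: complex assume z: "z \<in> ball 0 \<sigma>"
    show "(H has_field_derivative H' z) (at z within ball 0 \<sigma>)"
      by (rule has_field_derivative_at_within[OF Hd]) (use z \<sigma> in simp)
    show "norm (H' z - 1) \<le> \<kappa>" using z by (intro H1) simp
  qed (use \<kappa> in auto)
  obtain G where G: "G holomorphic_on H ` ball 0 \<sigma>" "\<And>z. z \<in> ball 0 \<sigma> \<Longrightarrow> G (H z) = z"
    using holomorphic_has_inverse[OF Hh open_ball Hinj] by metis
  have onto: "\<exists>v\<in>ball 0 \<sigma>. H v = y" if y: "y \<in> ball 0 \<rho>'" for y
  proof -
    have "continuous_on (cball 0 (\<rho>' + \<kappa>)) H"
      using \<kappa> by (intro holomorphic_on_imp_continuous_on holomorphic_on_subset[OF Hh]) auto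
    then obtain z where "z \<in> cball 0 (\<rho>' + \<kappa>)" "H z = y"
    proof (rule near_identity_onto[of "\<rho>' + \<kappa>" H \<kappa> y])
      show "norm (H z - z) \<le> \<kappa>" if "z \<in> cball 0 (\<rho>' + \<kappa>)" for z
        using that \<kappa> by (intro Hnear) simp
      show "norm y + \<kappa> \<le> \<rho>' + \<kappa>" using y by simp
    qed (use \<kappa> \<rho> \<sigma> in auto)
    thus ?thesis using \<kappa> by (intro bexI[of _ z]) auto
  qed
  \<comment> \<open>\<open>F\<close> inverts \<open>\<Theta>\<close> only up to the near-identity
    map \<open>H\<close>; composing \<open>\<Theta>\<close> with the inverse \<open>G\<close> of
    \<open>H\<close> makes the inversion exact.\<close>
  define T where "T = (\<lambda>y. \<Theta> (G y))"
  have Gb: "G y \<in> ball 0 \<sigma> \<and> H (G y) = y" if "y \<in> ball 0 \<rho>'" for y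
    using onto[OF that] G(2) by auto
  have FT: "F (T v) = v" if "v \<in> ball 0 \<rho>'" for v using Gb[OF that] by (simp add: T_def H_def)
  have "T holomorphic_on ball 0 \<rho>'"
  proof -
    have "G holomorphic_on ball 0 \<rho>'" using onto by (intro holomorphic_on_subset[OF G(1)]) blast
    moreover have "G ` ball 0 \<rho>' \<subseteq> ball 0 1" using Gb \<sigma> by fastforce
    ultimately have "\<Theta> \<circ> G holomorphic_on ball 0 \<rho>'"
      using \<Theta>(1) holomorphic_on_compose_gen by blast
    thus ?thesis by (simp add: T_def o_def)
  qed
  moreover have "inj_on T (ball 0 \<rho>')" using FT by (metis inj_onI)
  moreover have "T 0 = 0" using G(2)[of 0] \<sigma> H0 by (simp add: T_def \<Theta>)
  moreover have "T ` ball 0 \<rho>' \<subseteq> \<Theta> ` ball 0 1" using Gb \<sigma> unfolding T_def by fastforce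
  moreover have "\<Theta> ` ball 0 \<rho> \<subseteq> T ` ball 0 \<rho>'"
  proof
    fix x assume "x \<in> \<Theta> ` ball 0 \<rho>"
    then obtain v where v: "v \<in> ball 0 \<rho>" "x = \<Theta> v" by blast
    have "norm (H v) < \<rho>'"
      using Hnear[of v] v \<sigma> \<kappa> norm_triangle_sub[of "H v" v] by auto
    moreover have "T (H v) = x" using G(2)[of v] v \<sigma> by (simp add: T_def)
    ultimately show "x \<in> T ` ball 0 \<rho>'" by (intro image_eqI[of _ _ "H v"]) auto
  qed
  moreover have "F holomorphic_on UNIV" using F by (auto simp: holomorphic_on_open)
  moreover have "deriv F z \<noteq> 0" for z using DERIV_imp_deriv[OF F, of z] by simp
  moreover have "F 0 = 0" by (simp add: F_def F1_def)
  moreover have "F u = 0"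
  proof -
    have "F1 u \<noteq> 0" using u M by auto
    hence "F1 u / B = 2 * of_real pi * \<i>" by (simp add: B_def)
    thus ?thesis by (simp add: F_def)
  qed
  moreover have "u \<noteq> 0" using u M by (auto simp: F1_def)
  moreover have "norm u < \<eta>"
    using u(1) b0(2) norm_triangle_sub[of u b0] unfolding d_def by (simp add: dist_norm norm_minus_commute field_simps)
  ultimately show ?thesis using that[of F u \<rho>' T] FT \<sigma> by blast
qed

subsection \<open>Flows of entire vector fields\<close>

lemma exp_Taylor_2:
  fixes x :: complex assumes "norm x \<le> 1"
  shows "norm (exp x - (1 + x)) \<le> 3 * (norm x)\<^sup>2"
proof -
  have "norm (exp x - (\<Sum>i\<le>1. exp 0 * (x - 0) ^ i / fact i)) \<le> 3 * norm (x - 0) ^ Suc 1 / fact 1"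
  proof (rule field_Taylor[of "cball 0 1" 1 "\<lambda>_. exp"])
    fix y :: complex assume "y \<in> cball 0 1"
    hence "exp (norm y) \<le> exp 1" by simp
    thus "norm (exp y) \<le> 3" using norm_exp[of y] exp_le by linarith
  qed (use assms in \<open>auto intro!: derivative_eq_intros\<close>)
  thus ?thesis by (simp add: power2_eq_square)
qed

text \<open>A discrete Gronwall estimate: the error \<open>\<delta>\<close> made in one step grows
  by a factor of at most \<open>exp (norm w)\<close> in each later step.\<close>

lemma exp_iterate_bound:
  fixes a :: "nat \<Rightarrow> complex"
  assumes "\<And>k. k < n \<Longrightarrow> norm (a (Suc k) - exp w * a k) \<le> \<delta>" and "\<delta> \<ge> 0"
  shows "norm (a n - exp (of_nat n * w) * a 0) \<le> real n * \<delta> * exp (real n * norm w)"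
  using assms
proof (induction n)
  case (Suc n)
  have "a (Suc n) - exp (of_nat (Suc n) * w) * a 0
      = (a (Suc n) - exp w * a n) + exp w * (a n - exp (of_nat n * w) * a 0)"
    by (simp add: algebra_simps exp_add)
  also have "norm \<dots> \<le> \<delta> + exp (norm w) * (real n * \<delta> * exp (real n * norm w))"
    using Suc by (intro norm_triangle_mono) (auto simp: norm_mult complex_Re_le_cmod intro!: mult_mono)
  also have "\<dots> = \<delta> + real n * \<delta> * exp (real (Suc n) * norm w)"
    by (simp add: exp_add algebra_simps)
  also have "\<dots> \<le> \<delta> * exp (real (Suc n) * norm w) + real n * \<delta> * exp (real (Suc n) * norm w)"
    using Suc.prems(2) mult_left_mono[of 1 "exp (real (Suc n) * norm w)" \<delta>] by simp
  finally show ?case by (simp add: algebra_simps)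
qed auto

text \<open>The flow is a Montel limit of Euler schemes: no existence theory for differential equations
  is needed, since an eigenfunction \<open>V\<close> of the vector field is multiplied by \<open>1 + c h + O(h\<^sup>2)\<close>
  in every Euler step.\<close>

lemma holomorphic_flow:
  assumes X: "X holomorphic_on UNIV" and R: "R > 0" and e: "e > 0"
  obtains t0 where "t0 > 0" "\<And>t. 0 < t \<Longrightarrow> t \<le> t0 \<Longrightarrow>
     \<exists>g. g holomorphic_on ball 0 R \<and> (\<forall>z\<in>ball 0 R. norm (g z - z) \<le> e) \<and>
       (\<forall>z\<in>ball 0 R. X z = 0 \<longrightarrow> g z = z) \<and> (X 0 = 0 \<longrightarrow> deriv g 0 = exp (of_real t * deriv X 0)) \<and>
       (\<forall>V c. V holomorphic_on UNIV \<longrightarrow> (\<forall>z. X z * deriv V z = c * V z) \<longrightarrow>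
          (\<forall>z\<in>ball 0 R. V (g z) = exp (c * of_real t) * V z))"
proof -
  define C where "C = cball (0::complex) (R + e)"
  have bnd: "\<exists>B>0. \<forall>z\<in>C. norm (f z) \<le> B" if "f holomorphic_on UNIV" for f
  proof -
    have "compact (f ` C)" unfolding C_def
      by (intro compact_continuous_image holomorphic_on_imp_continuous_on holomorphic_on_subset[OF that]) auto
    thus ?thesis by (auto dest!: compact_imp_bounded simp: bounded_pos)
  qed
  obtain M where M: "M > 0" "\<And>z. z \<in> C \<Longrightarrow> norm (X z) \<le> M" using bnd[OF X] by blast
  \<comment> \<open>While the orbit stays in \<open>C\<close> its speed is at most \<open>M\<close>;
    up to time \<open>e / M\<close> it travels at most \<open>e\<close>, and so it does stay in
    \<open>C\<close>.\<close>
  define t0 where "t0 = e / M"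
  have t0: "t0 > 0" using M e by (simp add: t0_def)
  moreover have "\<exists>g. g holomorphic_on ball 0 R \<and> (\<forall>z\<in>ball 0 R. norm (g z - z) \<le> e) \<and>
       (\<forall>z\<in>ball 0 R. X z = 0 \<longrightarrow> g z = z) \<and> (X 0 = 0 \<longrightarrow> deriv g 0 = exp (of_real t * deriv X 0)) \<and>
       (\<forall>V c. V holomorphic_on UNIV \<longrightarrow> (\<forall>z. X z * deriv V z = c * V z) \<longrightarrow>
          (\<forall>z\<in>ball 0 R. V (g z) = exp (c * of_real t) * V z))"
    if t: "0 < t" "t \<le> t0" for t
  proof -
    \<comment> \<open>One Euler step of length \<open>t / (n + 1)\<close>; \<open>n + 1\<close> of
      them reach time \<open>t\<close>.\<close>
    define E where "E = (\<lambda>n z. z + of_real (t / real (Suc n)) * X z)"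
    have Eh: "(E n ^^ k) holomorphic_on UNIV" for n k
    proof (induction k)
      case 0
      show ?case by (simp add: id_def)
    next
      case (Suc k)
      have "E n holomorphic_on UNIV" unfolding E_def by (intro holomorphic_intros X)
      from holomorphic_on_compose_gen[OF Suc this] show ?case by (simp add: o_def)
    qed
    have kt: "real k * t / real (Suc n) * M \<le> e" if "k \<le> Suc n" for n k
    proof -
      have "real k / real (Suc n) \<le> 1" using that by (subst divide_le_eq_1_pos) auto
      hence "real k / real (Suc n) * (t * M) \<le> 1 * (t * M)" using t M by (intro mult_right_mono) auto
      also have "\<dots> \<le> e" using t M by (simp add: t0_def field_simps)
      finally show ?thesis by simp
    qed
    have Ed: "norm ((E n ^^ k) z - z) \<le> real k * t / real (Suc n) * M"
      if "k \<le> Suc n" "z \<in> ball 0 R" for n k z using that(1)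
    proof (induction k)
      case (Suc k)
      let ?w = "(E n ^^ k) z"
      have IH: "norm (?w - z) \<le> real k * t / real (Suc n) * M" using Suc by simp
      have "real k * t / real (Suc n) * M \<le> e" using Suc.prems by (intro kt) simp
      hence "?w \<in> C" using IH that(2) norm_triangle_sub[of ?w z] by (simp add: C_def)
      hence "norm (of_real (t / real (Suc n)) * X ?w) \<le> t / real (Suc n) * M"
        using M(2) t unfolding norm_mult norm_of_real by (intro mult_mono) auto
      moreover have "(E n ^^ Suc k) z - z = (?w - z) + of_real (t / real (Suc n)) * X ?w"
        by (simp add: E_def)
      ultimately have "norm ((E n ^^ Suc k) z - z) \<le> real k * t / real (Suc n) * M + t / real (Suc n) * M"
        using IH by (metis norm_triangle_mono)
      also have "\<dots> = real (Suc k) * t / real (Suc n) * M"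
        by (simp add: add_divide_distrib distrib_right)
      finally show ?case .
    qed auto
    have Ee: "norm ((E n ^^ k) z - z) \<le> e" if "k \<le> Suc n" "z \<in> ball 0 R" for n k z
      using Ed[OF that] kt[OF that(1)] by linarith
    have EC: "(E n ^^ k) z \<in> C" if "k \<le> Suc n" "z \<in> ball 0 R" for n k z
      using Ee[OF that] that(2) norm_triangle_sub[of "(E n ^^ k) z" z] by (simp add: C_def)
    define \<F> where "\<F> = (\<lambda>n. E n ^^ Suc n)"
    obtain g r where g: "g holomorphic_on ball 0 R" and r: "strict_mono (r :: nat \<Rightarrow> nat)"
      and lim: "\<And>x. x \<in> ball 0 R \<Longrightarrow> (\<lambda>n. \<F> (r n) x) \<longlonglongrightarrow> g x"
      and ulim: "\<And>K. compact K \<Longrightarrow> K \<subseteq> ball 0 R \<Longrightarrow> uniform_limit K (\<F> \<circ> r) g sequentially"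
    proof (rule Montel[of "ball 0 R" "range \<F>" \<F>])
      show "h holomorphic_on ball 0 R" if "h \<in> range \<F>" for h
        using that Eh by (auto simp: \<F>_def simp del: funpow.simps intro: holomorphic_on_subset)
      show "\<exists>B. \<forall>h\<in>range \<F>. \<forall>z\<in>K. norm (h z) \<le> B" if "compact K" "K \<subseteq> ball 0 R" for K
        using EC that unfolding \<F>_def C_def
        by (intro exI[of _ "R + e"]) (auto simp del: funpow.simps simp: subset_iff)
    qed auto
    have inv: "(\<lambda>n. K / real (Suc (r n))) \<longlonglongrightarrow> 0" for K
    proof -
      have "(\<lambda>n. K * inverse (real (Suc n))) \<longlonglongrightarrow> K * 0"
        by (intro tendsto_intros LIMSEQ_inverse_real_of_nat)
      hence "((\<lambda>n. K * inverse (real (Suc n))) \<circ> r) \<longlonglongrightarrow> 0"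
        using r by (intro LIMSEQ_subseq_LIMSEQ) auto
      thus ?thesis by (simp add: o_def divide_inverse)
    qed
    \<comment> \<open>Serves both the derivative at \<open>0\<close> and the eigenfunctions. Here
      \<open>a n k\<close> is the observed quantity after \<open>k\<close> steps of the
      \<open>n\<close>-th scheme: each step multiplies it by \<open>1 + c * h\<close> up to
      \<open>O(h^2)\<close> with \<open>h = t / (n + 1)\<close>, and the accumulated error is
      \<open>O(1 / n)\<close>.\<close>
    have expl: "(\<lambda>n. a (r n) (Suc (r n))) \<longlonglongrightarrow> exp (c * of_real t) * a0"
      if D: "D \<ge> 0" and a0: "\<And>n. a n 0 = a0"
        and B: "\<And>n k. k \<le> Suc n \<Longrightarrow> norm (a n k) \<le> B"
        and a: "\<And>n k. k \<le> n \<Longrightarrow>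
        norm (a n (Suc k) - (1 + c * of_real (t / real (Suc n))) * a n k) \<le> D * (t / real (Suc n))\<^sup>2"
      for a :: "nat \<Rightarrow> nat \<Rightarrow> complex" and c a0 D B
    proof -
      define K where "K = (D + 3 * (norm c)\<^sup>2 * B) * t\<^sup>2 * exp (norm c * t)"
      have B0: "B \<ge> 0" using B[of 0 0] norm_ge_zero[of "a 0 0"] by linarith
      have "norm (a n (Suc n) - exp (c * of_real t) * a0) \<le> K / real (Suc n)"
        if n: "norm c * t / real (Suc n) \<le> 1" for n
      proof -
        define h where "h = t / real (Suc n)"
        have h: "h > 0" "real (Suc n) * h = t" using t by (auto simp: h_def simp del: of_nat_Suc)
        define w where "w = c * of_real h"
        have nw: "norm w = norm c * h" using h by (simp add: w_def norm_mult)
        have w1: "norm w \<le> 1" using n nw by (simp add: h_def)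
        have "norm (a n (Suc n) - exp (of_nat (Suc n) * w) * a n 0)
            \<le> real (Suc n) * ((D + 3 * (norm c)\<^sup>2 * B) * h\<^sup>2) * exp (real (Suc n) * norm w)"
        proof (rule exp_iterate_bound)
          fix k assume k: "k < Suc n"
          have "a n (Suc k) - exp w * a n k = (a n (Suc k) - (1 + w) * a n k) - (exp w - (1 + w)) * a n k"
            by (simp add: algebra_simps)
          also have "norm \<dots> \<le> D * h\<^sup>2 + 3 * (norm w)\<^sup>2 * B"
          proof (rule order_trans[OF norm_triangle_ineq4 add_mono])
            show "norm (a n (Suc k) - (1 + w) * a n k) \<le> D * h\<^sup>2"
              using a[of k n] k by (simp add: w_def h_def)
            show "norm ((exp w - (1 + w)) * a n k) \<le> 3 * (norm w)\<^sup>2 * B"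
              unfolding norm_mult using exp_Taylor_2[OF w1] B[of k n] k by (intro mult_mono) auto
          qed
          also have "\<dots> = (D + 3 * (norm c)\<^sup>2 * B) * h\<^sup>2"
            by (simp add: nw power_mult_distrib algebra_simps)
          finally show "norm (a n (Suc k) - exp w * a n k) \<le> (D + 3 * (norm c)\<^sup>2 * B) * h\<^sup>2" .
        qed (use D B0 in auto)
        also have "real (Suc n) * norm w = norm c * t" unfolding nw h(2)[symmetric] by (simp del: of_nat_Suc)
        also have "real (Suc n) * ((D + 3 * (norm c)\<^sup>2 * B) * h\<^sup>2) * exp (norm c * t) = K / real (Suc n)"
          by (simp add: K_def h_def power2_eq_square del: of_nat_Suc)
        also have "of_nat (Suc n) * w = c * of_real t"
          unfolding w_def h(2)[symmetric] by (simp del: of_nat_Suc)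
        finally show ?thesis by (simp add: a0)
      qed
      moreover have "eventually (\<lambda>n. norm c * t / real (Suc (r n)) < 1) sequentially"
        by (rule order_tendstoD(2)[OF inv]) simp
      ultimately have "eventually (\<lambda>n. norm (a (r n) (Suc (r n)) - exp (c * of_real t) * a0) \<le> K / real (Suc (r n))) sequentially"
        by (auto elim: eventually_mono)
      from Lim_null_comparison[OF this inv]
      show ?thesis by (simp add: LIM_zero_iff)
    qed
    have gnear: "norm (g z - z) \<le> e" if "z \<in> ball 0 R" for z
    proof -
      have "(\<lambda>n. norm (\<F> (r n) z - z)) \<longlonglongrightarrow> norm (g z - z)" by (intro tendsto_intros lim that)
      moreover have "norm (\<F> (r n) z - z) \<le> e" for n unfolding \<F>_def using Ee[OF order_refl that] .
      ultimately show ?thesis using LIMSEQ_le_const2 by blast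
    qed
    have gfix: "g z = z" if "z \<in> ball 0 R" "X z = 0" for z
    proof -
      have "(E n ^^ k) z = z" for n k using that(2) by (induction k) (auto simp: E_def)
      hence "(\<lambda>n. \<F> (r n) z) = (\<lambda>n. z)" by (simp add: \<F>_def del: funpow.simps)
      thus ?thesis using lim[OF that(1)] by (simp add: LIMSEQ_const_iff)
    qed
    have gder: "deriv g 0 = exp (of_real t * deriv X 0)" if X0: "X 0 = 0"
    proof -
      define l where "l = deriv X 0"
      have E0: "(E n ^^ k) 0 = 0" for n k using X0 by (induction k) (auto simp: E_def)
      have "(X has_field_derivative l) (at 0)" unfolding l_def using X holomorphic_derivI by blast
      hence "((\<lambda>z. z + a * X z) has_field_derivative 1 + a * l) (at 0)" for a
        by (auto intro!: derivative_eq_intros)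
      hence dE: "(E n has_field_derivative 1 + of_real (t / real (Suc n)) * l) (at 0)" for n
        unfolding E_def .
      have dEk: "((E n ^^ k) has_field_derivative (1 + of_real (t / real (Suc n)) * l) ^ k) (at 0)" for n k
      proof (induction k)
        case (Suc k)
        have "(E n has_field_derivative 1 + of_real (t / real (Suc n)) * l) (at ((E n ^^ k) 0))"
          using dE E0 by simp
        from DERIV_chain[OF this Suc] show ?case by (simp add: o_def)
      qed (auto simp: id_def)
      have "(\<lambda>n. deriv ((\<F> \<circ> r) n) 0) \<longlonglongrightarrow> deriv g 0"
      proof (rule deriv_complex_uniform_limit)
        have "uniform_limit (cball 0 (R/2)) (\<F> \<circ> r) g sequentially" using R by (intro ulim) auto
        thus "uniform_limit (ball 0 (R/2)) (\<F> \<circ> r) g sequentially"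
          by (rule uniform_limit_on_subset) auto
        show "eventually (\<lambda>n. (\<F> \<circ> r) n holomorphic_on ball 0 (R/2)) sequentially"
          unfolding o_def \<F>_def by (intro always_eventually allI holomorphic_on_subset[OF Eh]) simp
      qed (use R in auto)
      moreover have "deriv ((\<F> \<circ> r) n) 0 = (1 + of_real (t / real (Suc (r n))) * l) ^ Suc (r n)" for n
        using DERIV_imp_deriv[OF dEk] by (simp add: \<F>_def del: funpow.simps power_Suc)
      ultimately have "(\<lambda>n. (1 + of_real (t / real (Suc (r n))) * l) ^ Suc (r n)) \<longlonglongrightarrow> deriv g 0" by simp
      moreover have "(\<lambda>n. (1 + of_real (t / real (Suc (r n))) * l) ^ Suc (r n)) \<longlonglongrightarrow> exp (l * of_real t) * 1"
      \<comment> \<open>The defect constant is 0: at the fixed point the derivative of an iterate is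
        an exact power.\<close>
      proof (rule expl[of 0 "\<lambda>n k. (1 + of_real (t / real (Suc n)) * l) ^ k" 1 "exp (norm l * t)" l])
        fix n k :: nat assume k: "k \<le> Suc n"
        have b: "norm (1 + of_real (t / real (Suc n)) * l) \<le> exp (t / real (Suc n) * norm l)"
        proof -
          have "norm (1 + of_real (t / real (Suc n)) * l) \<le> 1 + t / real (Suc n) * norm l"
            using norm_triangle_ineq[of 1 "of_real (t / real (Suc n)) * l"] t
            unfolding norm_mult norm_of_real by simp
          also have "\<dots> \<le> exp (t / real (Suc n) * norm l)" by (rule exp_ge_add_one_self)
          finally show ?thesis .
        qed
        have "norm ((1 + of_real (t / real (Suc n)) * l) ^ k) \<le> exp (t / real (Suc n) * norm l) ^ k"
          unfolding norm_power by (intro power_mono b) auto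
        also have "\<dots> = exp (real k * (t / real (Suc n) * norm l))" by (rule exp_of_nat_mult[symmetric])
        also have "real k * (t / real (Suc n) * norm l) \<le> real (Suc n) * (t / real (Suc n) * norm l)"
          using k t by (intro mult_right_mono) auto
        also have "\<dots> = norm l * t" by (simp del: of_nat_Suc)
        finally show "norm ((1 + of_real (t / real (Suc n)) * l) ^ k) \<le> exp (norm l * t)" by simp
      qed (auto simp: algebra_simps)
      ultimately show ?thesis using LIMSEQ_unique by (fastforce simp: l_def mult.commute)
    qed
    have gV: "V (g z) = exp (c * of_real t) * V z"
      if V: "V holomorphic_on UNIV" and XV: "\<forall>z. X z * deriv V z = c * V z" and z: "z \<in> ball 0 R" for V c z
    proof -
      obtain B where B: "B > 0" "\<And>z. z \<in> C \<Longrightarrow> norm (V z) \<le> B" using bnd[OF V] by blast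
      have V': "deriv V holomorphic_on UNIV" by (rule holomorphic_deriv[OF V open_UNIV])
      have V'': "deriv (deriv V) holomorphic_on UNIV" by (rule holomorphic_deriv[OF V' open_UNIV])
      obtain B2 where B2: "B2 > 0" "\<And>z. z \<in> C \<Longrightarrow> norm (deriv (deriv V) z) \<le> B2" using bnd[OF V''] by blast
      \<comment> \<open>Second-order Taylor expansion along the Euler step; the eigenvalue equation
        turns the linear term into \<open>c * h * V y\<close>.\<close>
      have step: "norm (V (y + of_real h * X y) - (1 + c * of_real h) * V y) \<le> B2 * M\<^sup>2 * h\<^sup>2"
        if y: "y \<in> C" "y + of_real h * X y \<in> C" and h: "h \<ge> 0" for y h
      proof -
        define w where "w = y + of_real h * X y"
        define f where "f = (\<lambda>i::nat. if i = 0 then V else if i = 1 then deriv V else deriv (deriv V))"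
        have T: "norm (f 0 w - (\<Sum>i\<le>1. f i y * (w - y) ^ i / fact i)) \<le> B2 * norm (w - y) ^ Suc 1 / fact 1"
        proof (rule complex_Taylor[of C 1 f])
          show "convex C" by (simp add: C_def)
          show "(f i has_field_derivative f (Suc i) x) (at x within C)" if "i \<le> 1" for i x
          proof (cases "i = 0")
            case True
            thus ?thesis using holomorphic_derivI[OF V] by (simp add: f_def has_field_derivative_at_within)
          next
            case False
            hence "i = 1" using that by simp
            thus ?thesis using holomorphic_derivI[OF V'] by (simp add: f_def has_field_derivative_at_within)
          qed
        qed (use y B2 in \<open>auto simp: f_def w_def\<close>)
        have S: "(\<Sum>i\<le>1. f i y * (w - y) ^ i / fact i) = (1 + c * of_real h) * V y"
        proof -
          have "deriv V y * (of_real h * X y) = of_real h * (c * V y)" using XV by (metis mult.assoc mult.commute)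
          thus ?thesis by (simp add: f_def w_def algebra_simps)
        qed
        have "norm (V w - (1 + c * of_real h) * V y) \<le> B2 * norm (w - y) ^ 2"
          using T unfolding S by (simp add: f_def power2_eq_square)
        also have "\<dots> \<le> B2 * (h * M) ^ 2"
          using B2(1) M(2)[OF y(1)] h
          by (intro mult_left_mono power_mono) (auto simp: w_def norm_mult mult_left_mono)
        finally show ?thesis by (simp add: w_def power_mult_distrib mult_ac)
      qed
      have "(\<lambda>n. V ((E (r n) ^^ Suc (r n)) z)) \<longlonglongrightarrow> exp (c * of_real t) * V z"
      proof (rule expl[of "B2 * M\<^sup>2" "\<lambda>n k. V ((E n ^^ k) z)" "V z" B c])
        fix n k :: nat assume k: "k \<le> n"
        have "(E n ^^ Suc k) z = (E n ^^ k) z + of_real (t / real (Suc n)) * X ((E n ^^ k) z)"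
          by (simp add: E_def)
        moreover have "(E n ^^ Suc k) z \<in> C" "(E n ^^ k) z \<in> C" using EC k z by (auto simp del: funpow.simps)
        ultimately show "norm (V ((E n ^^ Suc k) z) - (1 + c * of_real (t / real (Suc n))) * V ((E n ^^ k) z))
            \<le> B2 * M\<^sup>2 * (t / real (Suc n))\<^sup>2"
          using step[of "(E n ^^ k) z" "t / real (Suc n)"] t by simp
      next
        show "0 \<le> B2 * M\<^sup>2" using B2 by simp
        show "V ((E n ^^ 0) z) = V z" for n by simp
        show "norm (V ((E n ^^ k) z)) \<le> B" if "k \<le> Suc n" for n k using B(2)[OF EC[OF that z]] .
      qed
      moreover have "(\<lambda>n. V (\<F> (r n) z)) \<longlonglongrightarrow> V (g z)"
        using V lim[OF z] by (intro continuous_on_tendsto_compose[of UNIV V] holomorphic_on_imp_continuous_on) auto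
      ultimately show ?thesis unfolding \<F>_def using LIMSEQ_unique by blast
    qed
    show ?thesis using g gnear gfix gder gV by (intro exI[of _ g]) blast
  qed
  ultimately show ?thesis using that by blast
qed

subsection \<open>Lifts and rotations\<close>

lemma ball_power_root:
  assumes "q > 0" "r > 0"
  shows "norm w < root q r \<longleftrightarrow> norm (w ^ q :: complex) < r"
proof -
  have "root q r ^ q \<le> norm w ^ q \<longleftrightarrow> root q r \<le> norm w"
    using assms by (intro power_mono_iff) auto
  moreover have "root q r ^ q = r" using assms by simp
  ultimately show ?thesis by (metis norm_power not_le)
qed

text \<open>The function \<open>T v / v\<close> extends without zeros to the disc and so has a
  logarithm \<open>l\<close>; then \<open>S w = w * exp (l (w ^ q) / q)\<close> is a
  \<open>q\<close>-th root of \<open>T (w ^ q)\<close>. It commutes with multiplication by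
  \<open>q\<close>-th roots of unity, which yields injectivity and shows that its image is the full
  preimage.\<close>

lemma univalent_root_lift:
  assumes T: "T holomorphic_on ball 0 r" "inj_on T (ball 0 r)" "T 0 = 0" and r: "r > 0" and q: "q > 0"
  obtains S where "S holomorphic_on ball 0 (root q r)" "inj_on S (ball 0 (root q r))" "S 0 = 0"
    "\<And>w. w \<in> ball 0 (root q r) \<Longrightarrow> S w ^ q = T (w ^ q)"
    "S ` ball 0 (root q r) = {z. z ^ q \<in> T ` ball 0 r}"
proof -
  define D where "D = (\<lambda>v. if v = 0 then deriv T 0 else (T v - T 0) / (v - 0))"
  have D: "D holomorphic_on ball 0 r" unfolding D_def by (rule pole_lemma_open) (use T in auto)
  have Dnz: "D v \<noteq> 0" if "v \<in> ball 0 r" for v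
    using that r T holomorphic_injective_imp_regular[OF T(1) open_ball T(2), of 0]
    by (auto simp: D_def inj_on_def)
  obtain l where l: "l holomorphic_on ball 0 r" "\<And>v. v \<in> ball 0 r \<Longrightarrow> exp (l v) = D v"
    using holomorphic_logarithm_exists[of "ball 0 r" D 0] D Dnz r by auto
  have wq: "w ^ q \<in> ball 0 r" if "w \<in> ball 0 (root q r)" for w :: complex
    using that ball_power_root[OF q r, of w] by simp
  define S where "S = (\<lambda>w. w * exp (l (w ^ q) / of_nat q))"
  have Sq: "S w ^ q = T (w ^ q)" if "w \<in> ball 0 (root q r)" for w
  proof -
    have "S w ^ q = w ^ q * exp (of_nat q * (l (w ^ q) / of_nat q))"
      unfolding exp_of_nat_mult by (simp add: S_def power_mult_distrib)
    also have "\<dots> = w ^ q * D (w ^ q)" using q l(2)[OF wq[OF that]] by simp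
    also have "v * D v = T v" for v using T(3) by (cases "v = 0") (auto simp: D_def)
    finally show ?thesis .
  qed
  have Szeta: "S (\<zeta> * w) = \<zeta> * S w" if "\<zeta> ^ q = 1" for \<zeta> w
    using that by (simp add: S_def power_mult_distrib)
  have S0: "S w = 0 \<longleftrightarrow> w = 0" for w by (simp add: S_def)
  have quot: "\<exists>\<zeta>. \<zeta> ^ q = 1 \<and> y = \<zeta> * x" if "y ^ q = x ^ q" "x \<noteq> 0" for x y :: complex
    using that by (intro exI[of _ "y / x"]) (simp add: power_divide)
  have "S holomorphic_on ball 0 (root q r)"
  proof -
    have "(\<lambda>w. l (w ^ q)) holomorphic_on ball 0 (root q r)"
      using wq by (intro holomorphic_on_compose_gen[OF _ l(1), unfolded o_def] holomorphic_intros) auto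
    thus ?thesis unfolding S_def using q by (intro holomorphic_intros) auto
  qed
  moreover have "inj_on S (ball 0 (root q r))"
  proof (rule inj_onI)
    fix x y assume xy: "x \<in> ball 0 (root q r)" "y \<in> ball 0 (root q r)" "S x = S y"
    have "T (x ^ q) = T (y ^ q)" using xy Sq by metis
    hence e: "y ^ q = x ^ q" using T(2) wq xy by (metis inj_onD)
    show "x = y"
    proof (cases "x = 0")
      case True
      thus ?thesis using xy S0 by metis
    next
      case False
      then obtain \<zeta> where z: "\<zeta> ^ q = 1" "y = \<zeta> * x" using quot e by blast
      hence "\<zeta> * S x = S x" using Szeta xy(3) by metis
      hence "\<zeta> = 1" using S0 False by simp
      thus ?thesis using z by simp
    qed
  qed
  moreover have "S ` ball 0 (root q r) = {z. z ^ q \<in> T ` ball 0 r}"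
  proof safe
    fix w :: complex assume w: "w \<in> ball 0 (root q r)"
    show "S w ^ q \<in> T ` ball 0 r" using Sq[OF w] wq[OF w] by auto
  next
    fix z v assume v: "z ^ q = T v" "v \<in> ball 0 r"
    obtain x where x: "v = x ^ q" using exists_complex_root[of q v] q by auto
    have xb: "x \<in> ball 0 (root q r)" using v x ball_power_root[OF q r, of x] by simp
    have e: "z ^ q = S x ^ q" using v x Sq[OF xb] by simp
    show "z \<in> S ` ball 0 (root q r)"
    proof (cases "S x = 0")
      case True
      hence "z ^ q = 0" using e q by (simp add: zero_power)
      hence "z = S x" using True by simp
      thus ?thesis using xb by blast
    next
      case False
      then obtain \<zeta> where z: "\<zeta> ^ q = 1" "z = \<zeta> * S x" using quot e by blast
      have "(\<zeta> * x) ^ q = x ^ q" using z by (simp add: power_mult_distrib)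
      hence "\<zeta> * x \<in> ball 0 (root q r)" using xb ball_power_root[OF q r] by (metis dist_0_norm mem_ball)
      thus ?thesis using z Szeta by (intro image_eqI[of _ _ "\<zeta> * x"]) auto
    qed
  qed
  ultimately show ?thesis using that[of S] Sq by (simp add: S_def)
qed

lemma finite_roots:
  assumes "q > 0" shows "finite {z::complex. z ^ q = 1}"
  using card_roots_unity_eq[OF assms] assms card_ge_0_finite by metis

text \<open>A map preserving \<open>U\<close> acts as a rotation in the coordinate in which \<open>U\<close> is \<open>w\<^sup>q\<close>:
  the quotient \<open>\<kappa>(w) / w\<close> takes values in the finite set of \<open>q\<close>-th roots of unity.\<close>

lemma rotation_if_preserves_power:
  assumes \<Psi>: "\<Psi> holomorphic_on ball 0 s" "inj_on \<Psi> (ball 0 s)" "\<Psi> 0 = 0" "\<Psi> ` ball 0 s \<subseteq> A"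
    and U: "\<And>w. w \<in> ball 0 s \<Longrightarrow> U (\<Psi> w) = w ^ q" and q: "q > 0"
    and f: "f holomorphic_on A" "open A" "f 0 = 0" "\<And>z. z \<in> A \<Longrightarrow> U (f z) = U z"
    and \<zeta>: "norm (deriv f 0) = 1" and w: "w \<in> ball 0 s"
  shows "f (\<Psi> w) = \<Psi> (deriv f 0 * w)"
proof -
  have s: "s > 0" using w norm_ge_zero[of w] unfolding mem_ball dist_0_norm by linarith
  define k where "k = (\<lambda>w. f (\<Psi> w))"
  have k: "k holomorphic_on ball 0 s" unfolding k_def
    using holomorphic_on_compose_gen[OF \<Psi>(1) f(1) \<Psi>(4)] by (simp add: o_def)
  have k0: "k 0 = 0" by (simp add: k_def \<Psi> f)
  have oim: "open (\<Psi> ` ball 0 s)" by (rule open_mapping_thm3[OF \<Psi>(1) open_ball \<Psi>(2)])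
  obtain P where P: "P holomorphic_on \<Psi> ` ball 0 s"
    "\<And>z. z \<in> ball 0 s \<Longrightarrow> deriv \<Psi> z * deriv P (\<Psi> z) = 1" "\<And>z. z \<in> ball 0 s \<Longrightarrow> P (\<Psi> z) = z"
    using holomorphic_has_inverse[OF \<Psi>(1) open_ball \<Psi>(2)] by metis
  \<comment> \<open>Invariance of the chart image under \<open>f\<close> is not known in advance, so
    \<open>f\<close> can be read in the chart only near \<open>0\<close> at first.\<close>
  obtain \<epsilon> where \<epsilon>: "\<epsilon> > 0" "\<epsilon> \<le> s" "k ` ball 0 \<epsilon> \<subseteq> \<Psi> ` ball 0 s"
  proof -
    have "open (ball 0 s \<inter> k -` (\<Psi> ` ball 0 s))"
      using k holomorphic_on_imp_continuous_on continuous_open_preimage open_ball oim by blast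
    moreover have "0 \<in> ball 0 s \<inter> k -` (\<Psi> ` ball 0 s)"
      using s k0 \<Psi>(3) by (auto intro!: image_eqI[of _ _ 0])
    ultimately obtain e where e: "e > 0" "ball 0 e \<subseteq> ball 0 s \<inter> k -` (\<Psi> ` ball 0 s)"
      using open_contains_ball by blast
    show ?thesis using e s by (intro that[of "min e s"]) auto
  qed
  define \<kappa> where "\<kappa> = (\<lambda>w. P (k w))"
  have \<kappa>h: "\<kappa> holomorphic_on ball 0 \<epsilon>" unfolding \<kappa>_def
    using holomorphic_on_compose_gen[OF holomorphic_on_subset[OF k] P(1) \<epsilon>(3)] \<epsilon>(2) by (simp add: o_def subset_ball)
  have \<kappa>b: "\<kappa> w \<in> ball 0 s \<and> \<Psi> (\<kappa> w) = k w" if "w \<in> ball 0 \<epsilon>" for w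
    using \<epsilon>(3) that P(3) unfolding \<kappa>_def by force
  have \<kappa>q: "\<kappa> w ^ q = w ^ q" if w: "w \<in> ball 0 \<epsilon>" for w
  proof -
    have ws: "w \<in> ball 0 s" using w \<epsilon> by auto
    have "\<kappa> w ^ q = U (k w)" using \<kappa>b[OF w] U by metis
    also have "\<dots> = w ^ q" unfolding k_def using f(4)[of "\<Psi> w"] \<Psi>(4) ws U[OF ws] by (metis image_subset_iff)
    finally show ?thesis .
  qed
  have \<kappa>0: "\<kappa> 0 = 0" using \<kappa>q[of 0] \<epsilon> q by (simp add: zero_power)
  have d\<kappa>: "deriv \<kappa> 0 = deriv f 0"
  proof -
    have 0: "0 \<in> ball (0::complex) s" using s by simp
    have A0: "0 \<in> A" using \<Psi>(3,4) 0 by (metis image_subset_iff)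
    have "(\<Psi> has_field_derivative deriv \<Psi> 0) (at 0)" using \<Psi>(1) 0 holomorphic_derivI open_ball by blast
    moreover have "(f has_field_derivative deriv f 0) (at (\<Psi> 0))"
      using f A0 holomorphic_derivI \<Psi>(3) by metis
    ultimately have "(k has_field_derivative deriv f 0 * deriv \<Psi> 0) (at 0)"
      unfolding k_def by (rule DERIV_chain2[rotated])
    moreover have "(P has_field_derivative deriv P 0) (at (k 0))"
      using P(1) oim k0 0 \<Psi>(3) holomorphic_derivI by (metis imageI)
    ultimately have "(\<kappa> has_field_derivative deriv P 0 * (deriv f 0 * deriv \<Psi> 0)) (at 0)"
      unfolding \<kappa>_def by (rule DERIV_chain2[rotated])
    moreover have "deriv \<Psi> 0 * deriv P 0 = 1" using P(2)[OF 0] \<Psi>(3) by simp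
    hence "deriv P 0 * (deriv f 0 * deriv \<Psi> 0) = deriv f 0" by (metis mult.assoc mult.commute mult_1)
    ultimately show ?thesis using DERIV_imp_deriv by metis
  qed
  define Q where "Q = (\<lambda>w. if w = 0 then deriv \<kappa> 0 else (\<kappa> w - \<kappa> 0) / (w - 0))"
  have "Q holomorphic_on ball 0 \<epsilon>" unfolding Q_def by (rule pole_lemma_open[OF \<kappa>h open_ball])
  hence Qc: "continuous_on (ball 0 \<epsilon>) Q" by (rule holomorphic_on_imp_continuous_on)
  have "Q ` ball 0 \<epsilon> \<subseteq> insert (deriv \<kappa> 0) {z. z ^ q = 1}"
    using \<kappa>q \<kappa>0 by (auto simp: Q_def power_divide)
  hence "finite (Q ` ball 0 \<epsilon>)" using finite_roots[OF q] finite_subset by blast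
  hence "Q constant_on ball 0 \<epsilon>" using continuous_finite_range_constant[OF connected_ball Qc] by blast
  hence Qe: "Q w = deriv f 0" if "w \<in> ball 0 \<epsilon>" for w
    using that \<epsilon>(1) d\<kappa> unfolding constant_on_def Q_def by (metis centre_in_ball)
  have near: "k w = \<Psi> (deriv f 0 * w)" if w: "w \<in> ball 0 \<epsilon>" for w
  proof -
    have "\<kappa> w = deriv f 0 * w" using Qe[OF w] \<kappa>0 by (cases "w = 0") (auto simp: Q_def field_simps)
    thus ?thesis using \<kappa>b[OF w] by simp
  qed
  \<comment> \<open>The multiplier has modulus 1, so both sides are defined on the whole disc, and
    the identity near \<open>0\<close> extends by analytic continuation.\<close>
  have "(\<lambda>w. \<Psi> (deriv f 0 * w)) holomorphic_on ball 0 s"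
    using \<zeta> by (intro holomorphic_on_compose_gen[OF _ \<Psi>(1), unfolded o_def] holomorphic_intros)
      (auto simp: norm_mult)
  from analytic_continuation_open[OF open_ball[of 0 \<epsilon>] open_ball _ connected_ball _ k this near w]
  have "k w = \<Psi> (deriv f 0 * w)" using \<epsilon>(1) subset_ball[OF \<epsilon>(2), of 0] by simp
  thus ?thesis by (simp add: k_def)
qed

text \<open>The slit points away from \<open>0\<close>, so the slit disc is starlike about
  \<open>0\<close>, hence simply connected. A disc automorphism then moves the preimage of
  \<open>0\<close> to the centre.\<close>

lemma slit_disc_Riemann_map:
  assumes r: "r > 0" and \<delta>: "\<delta> > 0"
  obtains \<Theta> where "\<Theta> holomorphic_on ball 0 1" "inj_on \<Theta> (ball 0 1)" "\<Theta> 0 = 0"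
    "\<Theta> ` ball 0 1 = ball 0 r - of_real ` {\<delta>..}"
proof -
  define S where "S = ball 0 r - (of_real ` {\<delta>..} :: complex set)"
  have "closed (of_real ` {\<delta>..} :: complex set)"
  proof -
    have "(of_real ` {\<delta>..} :: complex set) = \<real> \<inter> {z. Re z \<ge> \<delta>}"
      by (auto simp: Reals_def)
    thus ?thesis by (simp add: closed_Int closed_complex_Reals closed_halfspace_Re_ge)
  qed
  hence oS: "open S" unfolding S_def by (intro open_Diff) auto
  have S0: "0 \<in> S" using r \<delta> by (auto simp: S_def)
  have "closed_segment 0 x \<subseteq> S" if x: "x \<in> S" for x
  proof
    fix y assume "y \<in> closed_segment 0 x"
    then obtain t where t: "0 \<le> t" "t \<le> 1" "y = of_real t * x"
      by (auto simp: closed_segment_def scaleR_conv_of_real)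
    have "norm y \<le> 1 * norm x" unfolding t norm_mult using t by (intro mult_right_mono) auto
    moreover have False if d: "of_real t * x = of_real a" "a \<ge> \<delta>" for a
    proof -
      have t0: "t > 0" using d \<delta> t by (cases "t = 0") auto
      hence "x = of_real (a / t)" using d by (simp add: field_simps)
      moreover have "a / t \<ge> \<delta>" using t t0 d(2) \<delta> by (smt (verit) le_divide_eq_1_pos frac_le div_by_1)
      ultimately show False using x unfolding S_def by (metis DiffD2 atLeast_iff imageI)
    qed
    ultimately show "y \<in> S" using x t by (auto simp: S_def)
  qed
  hence "starlike S" unfolding starlike_def using S0 by blast
  hence "simply_connected S" by (rule starlike_imp_simply_connected)
  moreover have "S \<noteq> UNIV" unfolding S_def by (metis Diff_subset UNIV_I bounded_ball bounded_subset not_bounded_UNIV)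
  ultimately obtain f g where fg: "f holomorphic_on S" "g holomorphic_on ball 0 1"
    "\<forall>z\<in>S. f z \<in> ball 0 1 \<and> g (f z) = z" "\<forall>z\<in>ball 0 1. g z \<in> S \<and> f (g z) = z"
    using Riemann_mapping_theorem[of S] oS S0 by blast
  have f0: "f 0 \<in> ball 0 1" using fg S0 by blast
  obtain m n where mn: "m (f 0) = 0" "m holomorphic_on ball 0 1" "m ` ball 0 1 \<subseteq> ball 0 1"
    "n holomorphic_on ball 0 1" "n ` ball 0 1 \<subseteq> ball 0 1"
    "\<And>z. z \<in> ball 0 1 \<Longrightarrow> m (n z) = z" "\<And>z. z \<in> ball 0 1 \<Longrightarrow> n (m z) = z"
    using ball_biholomorphism_exists[OF f0] by metis
  define \<Theta> where "\<Theta> = (\<lambda>z. g (n z))"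
  have "\<Theta> holomorphic_on ball 0 1"
    using holomorphic_on_compose_gen[OF mn(4) fg(2) mn(5)] by (simp add: \<Theta>_def o_def)
  moreover have inv: "m (f (\<Theta> z)) = z" if "z \<in> ball 0 1" for z
  proof -
    have "n z \<in> ball 0 1" using that mn(5) by blast
    thus ?thesis using fg(4) mn(6)[OF that] by (simp add: \<Theta>_def)
  qed
  hence "inj_on \<Theta> (ball 0 1)" by (metis inj_onI)
  moreover have "\<Theta> 0 = 0" using mn(1) mn(7)[OF f0] fg(3) S0 by (simp add: \<Theta>_def)
  moreover have "\<Theta> ` ball 0 1 = S"
  proof
    show "\<Theta> ` ball 0 1 \<subseteq> S" using fg(4) mn(5) unfolding \<Theta>_def by blast
    show "S \<subseteq> \<Theta> ` ball 0 1"
    proof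
      fix z assume z: "z \<in> S"
      have fz: "f z \<in> ball 0 1" using fg(3) z by blast
      hence "m (f z) \<in> ball 0 1" using mn(3) by blast
      moreover have "\<Theta> (m (f z)) = z" using mn(7)[OF fz] fg(3) z by (simp add: \<Theta>_def)
      ultimately show "z \<in> \<Theta> ` ball 0 1" by (metis imageI)
    qed
  qed
  ultimately show ?thesis using that[of \<Theta>] by (simp add: S_def)
qed

text \<open>The set lies in the finitely many real lines spanned by the \<open>q\<close>-th roots of
  unity.\<close>

lemma negligible_power_real:
  assumes q: "q > 0"
  shows "negligible {w::complex. w ^ q \<in> of_real ` {0..}}"
proof -
  define Z where "Z = {z::complex. z ^ q = 1}"
  have finZ: "finite Z" unfolding Z_def by (rule finite_roots[OF q])
  have "{w::complex. w ^ q \<in> of_real ` {0..}} \<subseteq> (\<Union>\<zeta>\<in>Z. span {\<zeta>})"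
  proof
    fix w :: complex assume "w \<in> {w. w ^ q \<in> of_real ` {0..}}"
    then obtain x :: real where x: "w ^ q = of_real x" "x \<in> {0..}" by blast
    define y where "y = root q x"
    have y: "(of_real y :: complex) ^ q = of_real x" using x q unfolding y_def
      by (simp flip: of_real_power)
    show "w \<in> (\<Union>\<zeta>\<in>Z. span {\<zeta>})"
    proof (cases "y = 0")
      case True
      hence "w ^ q = 0" using x y q by (simp add: zero_power)
      moreover have "1 \<in> Z" by (simp add: Z_def)
      ultimately show ?thesis by (auto simp: span_zero)
    next
      case False
      hence "of_real y ^ q \<noteq> (0::complex)" by simp
      hence "w / of_real y \<in> Z" unfolding Z_def mem_Collect_eq power_divide using x(1) y by simp
      moreover have "w = y *\<^sub>R (w / of_real y)" using False by (simp add: scaleR_conv_of_real)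
      hence "w \<in> span {w / of_real y}" by (metis span_base span_mul singletonI)
      ultimately show ?thesis by blast
    qed
  qed
  moreover have "negligible (span {\<zeta>})" for \<zeta> :: complex
  proof (rule negligible_lowdim)
    have "dim (span {\<zeta>}) \<le> card {\<zeta>}" by (rule dim_le_card) auto
    thus "dim (span {\<zeta>}) < DIM(complex)" by simp
  qed
  hence "negligible (\<Union>\<zeta>\<in>Z. span {\<zeta>})" using finZ by (intro negligible_Union) auto
  ultimately show ?thesis using negligible_subset by blast
qed

text \<open>As \<open>\<rho>\<close> tends to 1, the sets increase to the disc of radius
  \<open>s\<close> without the lift \<open>N\<close> of the slit. \<open>N\<close> is null and stays
  null under \<open>\<Psi>\<close>, so continuity from below recovers the whole area.\<close>

lemma area_exhaustion:
  assumes \<Psi>: "\<Psi> holomorphic_on ball 0 s" "inj_on \<Psi> (ball 0 s)" and q: "q > 0" and \<delta>: "\<delta> > 0"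
    and \<Theta>: "\<Theta> holomorphic_on ball 0 1" "inj_on \<Theta> (ball 0 1)"
      "\<Theta> ` ball 0 1 = ball 0 (s ^ q) - of_real ` {\<delta>..}"
    and c: "c < emeasure lborel (\<Psi> ` ball 0 s)"
  obtains \<rho> where "0 < \<rho>" "\<rho> < 1"
    "c < emeasure lborel (\<Psi> ` {w \<in> ball 0 s. w ^ q \<in> \<Theta> ` ball 0 \<rho>})"
proof -
  \<comment> \<open>The shift by 2 makes even the first radius positive, namely 1/2.\<close>
  define \<rho> where "\<rho> = (\<lambda>k::nat. 1 - 1 / (real k + 2))"
  have \<rho>: "0 < \<rho> k" "\<rho> k < 1" for k by (auto simp: \<rho>_def field_simps)
  have \<rho>m: "\<rho> k \<le> \<rho> l" if "k \<le> l" for k l using that by (auto simp: \<rho>_def intro!: divide_left_mono)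
  define A where "A = (\<lambda>k. {w \<in> ball 0 s. w ^ q \<in> \<Theta> ` ball 0 (\<rho> k)})"
  have s: "norm w ^ q < s ^ q" if "norm w < s" for w :: complex
    using that q by (intro power_strict_mono) auto
  have openim: "open (\<Theta> ` ball 0 (\<rho> k))" for k
    using \<rho>[of k] by (intro open_mapping_thm3 holomorphic_on_subset[OF \<Theta>(1)] inj_on_subset[OF \<Theta>(2)]) auto
  have openA: "open (A k)" for k
  proof -
    have "open ((\<lambda>w::complex. w ^ q) -` (\<Theta> ` ball 0 (\<rho> k)))"
      by (rule open_vimage[OF openim]) (intro continuous_intros)
    moreover have "A k = ball 0 s \<inter> (\<lambda>w. w ^ q) -` (\<Theta> ` ball 0 (\<rho> k))" by (auto simp: A_def)
    ultimately show ?thesis by auto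
  qed
  have open\<Psi>: "open (\<Psi> ` S)" if "open S" "S \<subseteq> ball 0 s" for S
    using that by (intro open_mapping_thm3 holomorphic_on_subset[OF \<Psi>(1)] inj_on_subset[OF \<Psi>(2)])
  have A_sub: "A k \<subseteq> ball 0 s" for k by (auto simp: A_def)
  define N where "N = {w::complex. w \<in> ball 0 s \<and> w ^ q \<in> of_real ` {\<delta>..}}"
  have N: "negligible N"
    by (rule negligible_subset[OF negligible_power_real[OF q]]) (use \<delta> in \<open>auto simp: N_def\<close>)
  have "\<Psi> differentiable_on N"
  proof -
    have "\<Psi> differentiable_on ball 0 s"
      using \<Psi>(1) by (simp add: holomorphic_on_imp_differentiable_on)
    thus ?thesis by (rule differentiable_on_subset) (auto simp: N_def)
  qed
  hence N\<Psi>: "negligible (\<Psi> ` N)" by (intro negligible_differentiable_image_negligible N) auto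
  have cover: "ball 0 s \<subseteq> (\<Union>k. A k) \<union> N"
  proof
    fix w :: complex assume w: "w \<in> ball 0 s"
    show "w \<in> (\<Union>k. A k) \<union> N"
    proof (cases "w \<in> N")
      case False
      hence "w ^ q \<in> \<Theta> ` ball 0 1" unfolding \<Theta>(3) using w s[of w] by (auto simp: N_def norm_power)
      then obtain v where v: "norm v < 1" "w ^ q = \<Theta> v" by auto
      obtain n where n: "inverse (real (Suc n)) < 1 - norm v" using v reals_Archimedean[of "1 - norm v"] by auto
      have "1 / (real n + 2) \<le> inverse (real (Suc n))" by (simp add: divide_simps)
      hence "norm v < \<rho> n" using n by (simp add: \<rho>_def)
      hence "w \<in> A n" using w v by (auto simp: A_def)
      thus ?thesis by blast
    qed auto
  qed
  have "emeasure lborel (\<Psi> ` ball 0 s) \<le> emeasure lborel (\<Union>k. \<Psi> ` A k)"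
  proof -
    have m: "(\<Union>k. \<Psi> ` A k) \<in> sets lebesgue" "\<Psi> ` N \<in> sets lebesgue"
      using N\<Psi> open\<Psi>[OF openA A_sub] by (auto simp: negligible_imp_sets intro!: sets.countable_UN)
    have cover': "\<Psi> ` ball 0 s \<subseteq> (\<Union>k. \<Psi> ` A k) \<union> \<Psi> ` N" using cover by blast
    have "emeasure lborel (\<Psi> ` ball 0 s) = emeasure lebesgue (\<Psi> ` ball 0 s)"
      using open\<Psi>[OF open_ball] by (simp add: borel_open)
    also have "\<dots> \<le> emeasure lebesgue ((\<Union>k. \<Psi> ` A k) \<union> \<Psi> ` N)"
      using cover' m by (intro emeasure_mono sets.Un)
    also have "\<dots> \<le> emeasure lebesgue (\<Union>k. \<Psi> ` A k) + emeasure lebesgue (\<Psi> ` N)"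
      using m by (intro emeasure_subadditive)
    also have "emeasure lebesgue (\<Psi> ` N) = 0" using N\<Psi> by (auto simp: negligible_iff_null_sets)
    finally show ?thesis using open\<Psi>[OF openA A_sub] by (simp add: borel_open open_UN)
  qed
  also have "\<dots> = (SUP k. emeasure lborel (\<Psi> ` A k))"
  proof (rule SUP_emeasure_incseq[symmetric])
    show "range (\<lambda>k. \<Psi> ` A k) \<subseteq> sets lborel" using open\<Psi>[OF openA A_sub] by auto
    show "incseq (\<lambda>k. \<Psi> ` A k)"
    proof (rule incseq_SucI)
      fix k
      have "ball (0::complex) (\<rho> k) \<subseteq> ball 0 (\<rho> (Suc k))" by (intro subset_ball \<rho>m) simp
      thus "\<Psi> ` A k \<subseteq> \<Psi> ` A (Suc k)" unfolding A_def by blast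
    qed
  qed
  finally have "c < (SUP k. emeasure lborel (\<Psi> ` A k))" using c by order
  then obtain k where "c < emeasure lborel (\<Psi> ` A k)" by (auto simp: less_SUP_iff)
  thus ?thesis using that[of "\<rho> k"] \<rho> by (simp add: A_def)
qed

subsection \<open>The inductive construction\<close>

text \<open>Formally \<open>X = c * U / U'\<close>, and replacing \<open>U\<close> by
  \<open>F (U)\<close> multiplies the field by \<open>Q (U)\<close> with
  \<open>Q u = F u / (u * deriv F u)\<close>. \<open>Q\<close> is entire, and \<open>Q 0 = 1\<close>
  preserves the derivative of the field at \<open>0\<close>.\<close>

lemma eigenfield_compose:
  fixes U X F :: "complex \<Rightarrow> complex"
  assumes U: "U holomorphic_on UNIV" and X: "X holomorphic_on UNIV" and F: "F holomorphic_on UNIV"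
    and XU: "\<And>z. X z * deriv U z = c * U z" and X0: "\<And>z. U z = 0 \<Longrightarrow> X z = 0" and U0: "U 0 = 0"
    and F0: "F 0 = 0" and F': "\<And>u. deriv F u \<noteq> 0"
  obtains Y where "Y holomorphic_on UNIV" "\<And>z. Y z * deriv (\<lambda>z. F (U z)) z = c * F (U z)"
    "\<And>z. F (U z) = 0 \<Longrightarrow> Y z = 0" "deriv Y 0 = deriv X 0"
proof -
  define D where "D = (\<lambda>u. if u = 0 then deriv F 0 else (F u - F 0) / (u - 0))"
  have D: "D holomorphic_on UNIV" unfolding D_def by (rule pole_lemma_open[OF F open_UNIV])
  have uD: "u * D u = F u" for u by (auto simp: D_def F0)
  define Q where "Q = (\<lambda>u. D u / deriv F u)"
  have Q: "Q holomorphic_on UNIV" unfolding Q_def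
    by (intro holomorphic_intros D holomorphic_deriv[OF F] F') auto
  have QU: "(\<lambda>z. Q (U z)) holomorphic_on UNIV"
    using holomorphic_on_compose_gen[OF U Q] by (simp add: o_def)
  define Y where "Y = (\<lambda>z. X z * Q (U z))"
  have "Y holomorphic_on UNIV" unfolding Y_def by (intro holomorphic_intros X QU)
  moreover have "Y z * deriv (\<lambda>z. F (U z)) z = c * F (U z)" for z
  proof -
    have "(U has_field_derivative deriv U z) (at z)" "(F has_field_derivative deriv F (U z)) (at (U z))"
      using U F holomorphic_derivI by blast+
    hence "deriv (\<lambda>z. F (U z)) z = deriv F (U z) * deriv U z"
      using DERIV_chain2 DERIV_imp_deriv by blast
    hence "Y z * deriv (\<lambda>z. F (U z)) z = X z * deriv U z * D (U z)"
      using F'[of "U z"] by (simp add: Y_def Q_def)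
    also have "\<dots> = c * F (U z)" unfolding XU uD[symmetric] by (simp only: mult.assoc)
    finally show ?thesis .
  qed
  moreover have "Y z = 0" if "F (U z) = 0" for z
    using X0[of z] that by (cases "U z = 0") (auto simp: Y_def Q_def D_def F0)
  moreover have "deriv Y 0 = deriv X 0"
  proof -
    have "(X has_field_derivative deriv X 0) (at 0)"
      "((\<lambda>z. Q (U z)) has_field_derivative deriv (\<lambda>z. Q (U z)) 0) (at 0)"
      using X QU holomorphic_derivI by blast+
    hence "(Y has_field_derivative deriv X 0 * Q (U 0) + deriv (\<lambda>z. Q (U z)) 0 * X 0) (at 0)"
      unfolding Y_def by (rule DERIV_mult)
    moreover have "Q (U 0) = 1" using F'[of 0] by (simp add: Q_def D_def U0)
    ultimately show ?thesis using X0[OF U0] DERIV_imp_deriv by fastforce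
  qed
  ultimately show ?thesis using that by blast
qed

text \<open>The field is stored beside the integral map instead of being computed from it: the
  quotient \<open>U / U'\<close> has removable singularities at the critical points of
  \<open>U\<close>, where division would return 0.\<close>

record stage =
  period :: nat
  angle :: real
  integral_map :: "complex \<Rightarrow> complex"
  vfield :: "complex \<Rightarrow> complex"
  germ :: "complex \<Rightarrow> complex"
  chart :: "complex \<Rightarrow> complex"
  radius :: real

text \<open>The bound \<open>1/2 - 1 / 2 ^ Suc n\<close> leaves exactly the room for later
  corrections of size \<open>1 / 2 ^ (n + 2)\<close>. The strict area bound can be kept forever
  since each step may lose arbitrarily little. The fixed derivative of \<open>X\<close> at
  \<open>0\<close> makes the flow at time \<open>t\<close> add \<open>t\<close> to the
  angle.\<close>

definition valid_stage :: "nat \<Rightarrow> stage \<Rightarrow> bool" where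
  "valid_stage n S \<longleftrightarrow>
     (let q = period S; U = integral_map S; X = vfield S; f = germ S; \<Psi> = chart S; s = radius S in
      0 < q \<and> real q * angle S \<in> \<int> \<and>
      U holomorphic_on UNIV \<and> U 0 = 0 \<and> X holomorphic_on UNIV \<and> deriv X 0 = 2 * of_real pi * \<i> \<and>
      (\<forall>z. X z * deriv U z = 2 * of_real pi * \<i> * of_nat q * U z) \<and> (\<forall>z. U z = 0 \<longrightarrow> X z = 0) \<and>
      f holomorphic_on ball 0 4 \<and> f 0 = 0 \<and> deriv f 0 = exp (2 * of_real pi * \<i> * of_real (angle S)) \<and>
      (\<forall>z\<in>ball 0 4. norm (f z - z) \<le> 1/2 - 1 / 2 ^ Suc n \<and> U (f z) = U z) \<and>
      0 < s \<and> \<Psi> holomorphic_on ball 0 s \<and> inj_on \<Psi> (ball 0 s) \<and> \<Psi> 0 = 0 \<and>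
      \<Psi> ` ball 0 s \<subseteq> ball 0 2 \<and> (\<forall>w\<in>ball 0 s. U (\<Psi> w) = w ^ q) \<and>
      1 < emeasure lborel (\<Psi> ` ball 0 s))"

text \<open>The growth of the period serves irrationality. The cycle of \<open>\<delta>\<close>
  consists of zeros of \<open>U'\<close>; the two clauses on zeros transmit it unchanged to every
  later germ.\<close>

definition next_stage :: "nat \<Rightarrow> stage \<Rightarrow> stage \<Rightarrow> bool" where
  "next_stage n S S' \<longleftrightarrow>
     (let q = period S; q' = period S'; U = integral_map S; U' = integral_map S'; f = germ S; f' = germ S' in
      angle S' = angle S + 1 / real q' \<and> (n + 2) * q \<le> q' \<and>
      (\<forall>z\<in>ball 0 4. norm (f' z - f z) \<le> 1 / 2 ^ (n + 2) \<and> (U' (f z) = 0 \<longrightarrow> f' z = f z)) \<and>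
      (\<forall>z. U z = 0 \<longrightarrow> U' z = 0) \<and>
      (\<exists>\<delta>. \<delta> \<noteq> 0 \<and> (f ^^ q) \<delta> = \<delta> \<and>
         (\<forall>k. norm ((f ^^ k) \<delta>) < 1 / real (Suc n) \<and> U' ((f ^^ k) \<delta>) = 0)))"

lemma valid_stage_rotation:
  assumes "valid_stage n S" "w \<in> ball 0 (radius S)"
  shows "germ S (chart S w) = chart S (exp (2 * of_real pi * \<i> * of_real (angle S)) * w)"
proof -
  have v: "chart S holomorphic_on ball 0 (radius S)" "inj_on (chart S) (ball 0 (radius S))" "chart S 0 = 0"
    "chart S ` ball 0 (radius S) \<subseteq> ball 0 2" "\<forall>w\<in>ball 0 (radius S). integral_map S (chart S w) = w ^ period S"
    "0 < period S" "germ S holomorphic_on ball 0 4" "germ S 0 = 0"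
    "\<forall>z\<in>ball 0 4. integral_map S (germ S z) = integral_map S z"
    "deriv (germ S) 0 = exp (2 * of_real pi * \<i> * of_real (angle S))"
    using assms(1) unfolding valid_stage_def Let_def by blast+
  have "chart S ` ball 0 (radius S) \<subseteq> ball 0 4" using v(4) subset_ball[of 2 4 "0::complex"] by auto
  hence "germ S (chart S w) = chart S (deriv (germ S) 0 * w)"
  proof (rule rotation_if_preserves_power[where U = "integral_map S", OF v(1-3) _ _ v(6,7) open_ball v(8) _ _ assms(2)])
    show "norm (deriv (germ S) 0) = 1" unfolding v(10) by simp
  qed (use v(5,9) in blast)+
  thus ?thesis unfolding v(10) .
qed

lemma exp_angle_power:
  assumes "valid_stage n S"
  shows "exp (2 * of_real pi * \<i> * of_real (angle S)) ^ period S = 1"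
proof -
  obtain p :: int where p: "real (period S) * angle S = of_int p"
    using assms by (auto simp: valid_stage_def Let_def Ints_def)
  have "exp (2 * of_real pi * \<i> * of_real (angle S)) ^ period S
      = exp (of_nat (period S) * (2 * of_real pi * \<i> * of_real (angle S)))"
    by (rule exp_of_nat_mult[symmetric])
  also have "of_nat (period S) * (2 * of_real pi * \<i> * of_real (angle S)) =
      2 * of_real pi * \<i> * of_real (real (period S) * angle S)" by simp
  also have "\<dots> = 2 * of_real pi * \<i> * of_int p" unfolding p by simp
  also have "exp \<dots> = 1" using exp_integer_2pi[of "of_int p"] by (simp add: mult_ac)
  finally show ?thesis .
qed

text \<open>The order of choices matters: the size \<open>\<eta>\<close> of the zero, the slit, the
  radius \<open>\<rho>\<close> that keeps the area, then \<open>F\<close> and the field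
  \<open>Y\<close>, and \<open>m\<close> only after the flow time \<open>t0\<close> of
  \<open>Y\<close> is known. The new chart does not depend on \<open>m\<close>, since
  \<open>V\<close> is \<open>w ^ q\<close> in it and \<open>V ^ m\<close> is
  \<open>w ^ (q * m)\<close>; so a large \<open>m\<close> costs no area.\<close>

lemma next_stage_exists:
  assumes S: "valid_stage n S"
  shows "\<exists>S'. valid_stage (Suc n) S' \<and> next_stage n S S'"
proof -
  define q \<alpha> U X f \<Psi> s where "q = period S" and "\<alpha> = angle S" and "U = integral_map S"
    and "X = vfield S" and "f = germ S" and "\<Psi> = chart S" and "s = radius S"
  note defs = q_def \<alpha>_def U_def X_def f_def \<Psi>_def s_def
  have q: "q > 0" and q\<alpha>: "real q * \<alpha> \<in> \<int>" and U: "U holomorphic_on UNIV" "U 0 = 0"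
    and X: "X holomorphic_on UNIV" "deriv X 0 = 2 * of_real pi * \<i>"
    and XU: "\<And>z. X z * deriv U z = 2 * of_real pi * \<i> * of_nat q * U z" "\<And>z. U z = 0 \<Longrightarrow> X z = 0"
    and f: "f holomorphic_on ball 0 4" "f 0 = 0" "deriv f 0 = exp (2 * of_real pi * \<i> * of_real \<alpha>)"
    and fn: "\<And>z. z \<in> ball 0 4 \<Longrightarrow> norm (f z - z) \<le> 1/2 - 1 / 2 ^ Suc n"
    and fU: "\<And>z. z \<in> ball 0 4 \<Longrightarrow> U (f z) = U z"
    and s: "s > 0" and \<Psi>: "\<Psi> holomorphic_on ball 0 s" "inj_on \<Psi> (ball 0 s)" "\<Psi> 0 = 0" "\<Psi> ` ball 0 s \<subseteq> ball 0 2"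
    and U\<Psi>: "\<And>w. w \<in> ball 0 s \<Longrightarrow> U (\<Psi> w) = w ^ q" and area: "1 < emeasure lborel (\<Psi> ` ball 0 s)"
    using S unfolding valid_stage_def Let_def defs by blast+
  define \<zeta> where "\<zeta> = exp (2 * of_real pi * \<i> * of_real \<alpha>)"
  have rot: "f (\<Psi> w) = \<Psi> (\<zeta> * w)" if "w \<in> ball 0 s" for w
    using valid_stage_rotation[OF S] that unfolding \<zeta>_def defs by blast
  have \<zeta>q: "\<zeta> ^ q = 1" using exp_angle_power[OF S] unfolding \<zeta>_def defs .
  have \<zeta>n: "norm \<zeta> = 1" by (simp add: \<zeta>_def)
  obtain \<epsilon> where \<epsilon>: "\<epsilon> > 0" "\<epsilon> \<le> s" "\<And>w. norm w < \<epsilon> \<Longrightarrow> norm (\<Psi> w) < 1 / real (Suc n)"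
  proof -
    have "isCont \<Psi> 0"
      using \<Psi>(1) s continuous_on_eq_continuous_at[of "ball 0 s" \<Psi>] holomorphic_on_imp_continuous_on by auto
    then obtain d where d: "d > 0" "\<And>w. norm w < d \<Longrightarrow> norm (\<Psi> w) < 1 / real (Suc n)"
      unfolding continuous_at_eps_delta dist_norm \<Psi>(3) by (metis diff_zero of_nat_0_less_iff zero_less_Suc zero_less_divide_1_iff)
    thus ?thesis using s by (intro that[of "min d s"]) auto
  qed
  \<comment> \<open>A zero \<open>b\<close> of \<open>F\<close> gives cycle points with chart
    coordinates \<open>w\<close>, \<open>w ^ q = b\<close>; \<open>norm b < \<eta>\<close> means
    \<open>norm w < \<epsilon>\<close>.\<close>
  define \<eta> where "\<eta> = \<epsilon> ^ q"
  have \<eta>: "\<eta> > 0" using \<epsilon> by (simp add: \<eta>_def)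
  \<comment> \<open>The tip \<open>\<eta>/2\<close> of the slit is the point \<open>b0\<close> off
    the image and within \<open>\<eta>\<close> of \<open>0\<close>.\<close>
  obtain \<Theta> where \<Theta>: "\<Theta> holomorphic_on ball 0 1" "inj_on \<Theta> (ball 0 1)" "\<Theta> 0 = 0"
    "\<Theta> ` ball 0 1 = ball 0 (s ^ q) - of_real ` {\<eta>/2..}"
    using slit_disc_Riemann_map[of "s ^ q" "\<eta>/2"] s \<eta> by auto
  obtain \<rho> where \<rho>: "0 < \<rho>" "\<rho> < 1" "1 < emeasure lborel (\<Psi> ` {w \<in> ball 0 s. w ^ q \<in> \<Theta> ` ball 0 \<rho>})"
    using area_exhaustion[OF \<Psi>(1,2) q _ \<Theta>(1,2,4) area] \<eta> by auto
  have "of_real (\<eta>/2) \<in> (of_real ` {\<eta>/2..} :: complex set)" by (rule imageI) simp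
  hence "of_real (\<eta>/2) \<notin> \<Theta> ` ball 0 1" unfolding \<Theta>(4) by blast
  moreover have "norm (of_real (\<eta>/2) :: complex) < \<eta>" unfolding norm_of_real using \<eta> by simp
  ultimately obtain F T \<rho>' b where F: "F holomorphic_on UNIV" "F 0 = 0" "\<And>z. deriv F z \<noteq> 0"
    and b: "F b = 0" "b \<noteq> 0" "norm b < \<eta>" and \<rho>': "\<rho> < \<rho>'"
    and T: "T holomorphic_on ball 0 \<rho>'" "inj_on T (ball 0 \<rho>')" "T 0 = 0"
      "T ` ball 0 \<rho>' \<subseteq> \<Theta> ` ball 0 1" "\<Theta> ` ball 0 \<rho> \<subseteq> T ` ball 0 \<rho>'" "\<And>v. v \<in> ball 0 \<rho>' \<Longrightarrow> F (T v) = v"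
    using locally_univalent_with_small_zero[OF \<Theta>(1-3) \<rho>(1,2)] by metis
  define s' where "s' = root q \<rho>'"
  have \<rho>'0: "\<rho>' > 0" and s': "s' > 0" using \<rho> \<rho>' q by (auto simp: s'_def)
  obtain L where L0: "L holomorphic_on ball 0 (root q \<rho>')" "inj_on L (ball 0 (root q \<rho>'))" "L 0 = 0"
    "\<And>w. w \<in> ball 0 (root q \<rho>') \<Longrightarrow> L w ^ q = T (w ^ q)" "L ` ball 0 (root q \<rho>') = {z. z ^ q \<in> T ` ball 0 \<rho>'}"
  proof (rule univalent_root_lift[OF T(1-3) \<rho>'0 q], goal_cases)
    case (1 S)
    show ?case by (rule 1(1)) (rule 1(2-6), assumption?)+
  qed
  note L = L0[folded s'_def]
  have Lsub: "L ` ball 0 s' \<subseteq> ball 0 s"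
  proof
    fix z assume "z \<in> L ` ball 0 s'"
    hence "z ^ q \<in> ball 0 (s ^ q)" using L(5) T(4) \<Theta>(4) by blast
    hence "norm z ^ q < s ^ q" by (simp add: norm_power)
    thus "z \<in> ball 0 s" using s by (simp add: power_less_imp_less_base)
  qed
  define V where "V = (\<lambda>z. F (U z))"
  have V: "V holomorphic_on UNIV" unfolding V_def using holomorphic_on_compose_gen[OF U(1) F(1)] by (simp add: o_def)
  obtain Y where Y: "Y holomorphic_on UNIV" "\<And>z. Y z * deriv V z = 2 * of_real pi * \<i> * of_nat q * V z"
    "\<And>z. V z = 0 \<Longrightarrow> Y z = 0" "deriv Y 0 = 2 * of_real pi * \<i>"
    using eigenfield_compose[OF U(1) X(1) F(1) XU U(2) F(2,3)] X(2) unfolding V_def by metis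
  have Y0: "Y 0 = 0" by (rule Y(3)) (simp add: V_def U F)
  obtain t0 where t0: "t0 > 0" and flow: "\<And>t. 0 < t \<Longrightarrow> t \<le> t0 \<Longrightarrow>
     \<exists>g. g holomorphic_on ball 0 5 \<and> (\<forall>z\<in>ball 0 5. norm (g z - z) \<le> 1 / 2 ^ (n + 2)) \<and>
       (\<forall>z\<in>ball 0 5. Y z = 0 \<longrightarrow> g z = z) \<and> (Y 0 = 0 \<longrightarrow> deriv g 0 = exp (of_real t * deriv Y 0)) \<and>
       (\<forall>V c. V holomorphic_on UNIV \<longrightarrow> (\<forall>z. Y z * deriv V z = c * V z) \<longrightarrow>
          (\<forall>z\<in>ball 0 5. V (g z) = exp (c * of_real t) * V z))"
    using holomorphic_flow[OF Y(1), of 5 "1 / 2 ^ (n + 2)"] by auto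
  \<comment> \<open>The first condition gives the growth of the period, the second an admissible
    flow time \<open>1 / (q * m)\<close>.\<close>
  obtain m where m: "m \<ge> n + 2" "1 / real (q * m) \<le> t0"
  proof -
    obtain N where N: "inverse (real (Suc N)) < t0" using reals_Archimedean[OF t0] by blast
    define m where "m = max (n + 2) (Suc N)"
    have "Suc N \<le> 1 * m" by (simp add: m_def)
    also have "\<dots> \<le> q * m" using q by (intro mult_le_mono1) simp
    finally have "Suc N \<le> q * m" .
    hence "inverse (real (q * m)) \<le> inverse (real (Suc N))" by (intro le_imp_inverse_le) (auto simp del: of_nat_mult)
    thus ?thesis using N that[of m] by (simp add: m_def inverse_eq_divide del: of_nat_mult)
  qed
  define q' where "q' = q * m"
  define t where "t = 1 / real q'"
  have m0: "m > 0" using m by simp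
  have q': "q' > 0" using q m0 by (simp add: q'_def)
  have t: "0 < t" "t \<le> t0" using q' m(2) by (auto simp: t_def q'_def)
  obtain g where g: "g holomorphic_on ball 0 5" and gn: "\<And>z. z \<in> ball 0 5 \<Longrightarrow> norm (g z - z) \<le> 1 / 2 ^ (n + 2)"
    and gfix: "\<And>z. z \<in> ball 0 5 \<Longrightarrow> Y z = 0 \<Longrightarrow> g z = z" and dg: "deriv g 0 = exp (of_real t * (2 * of_real pi * \<i>))"
    and gV: "\<And>z. z \<in> ball 0 5 \<Longrightarrow> V (g z) = exp (2 * of_real pi * \<i> * of_nat q * of_real t) * V z"
    using flow[OF t] Y0 Y(2,4) V by metis
  define f' where "f' = (\<lambda>z. g (f z))"
  define U' where "U' = (\<lambda>z. V z ^ m)"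
  define \<Psi>' where "\<Psi>' = (\<lambda>w. \<Psi> (L w))"
  define S' where "S' = \<lparr>period = q', angle = \<alpha> + t, integral_map = U', vfield = Y, germ = f', chart = \<Psi>', radius = s'\<rparr>"
  have f5: "f z \<in> ball 0 5" if "z \<in> ball 0 4" for z
  proof -
    have "norm (f z) \<le> norm z + norm (f z - z)" by (rule norm_triangle_sub)
    moreover have "norm (f z - z) \<le> 1/2" using fn[OF that] by (rule order_trans) simp
    ultimately show ?thesis using that by simp
  qed
  have f'n: "norm (f' z - f z) \<le> 1 / 2 ^ (n + 2)" if "z \<in> ball 0 4" for z
    unfolding f'_def using gn[OF f5[OF that]] .
  have "real q' * (\<alpha> + t) \<in> \<int>"
  proof -
    have "real q' * (\<alpha> + t) = real m * (real q * \<alpha>) + 1" using q' by (simp add: t_def q'_def algebra_simps)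
    thus ?thesis using q\<alpha> by simp
  qed
  moreover have "U' holomorphic_on UNIV" unfolding U'_def by (intro holomorphic_intros V)
  moreover have "U' 0 = 0" using m0 by (simp add: U'_def V_def U F)
  moreover have "Y z * deriv U' z = 2 * of_real pi * \<i> * of_nat q' * U' z" for z
  proof -
    have "(V has_field_derivative deriv V z) (at z)" using V holomorphic_derivI by blast
    hence "(U' has_field_derivative of_nat m * V z ^ (m - 1) * deriv V z) (at z)"
      unfolding U'_def by (auto intro!: derivative_eq_intros)
    hence "Y z * deriv U' z = of_nat m * V z ^ (m - 1) * (Y z * deriv V z)"
      using DERIV_imp_deriv by (fastforce simp: mult_ac)
    also have "\<dots> = 2 * of_real pi * \<i> * of_nat q' * (V z * V z ^ (m - 1))" unfolding Y(2) by (simp add: q'_def)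
    also have "V z * V z ^ (m - 1) = U' z" using m0 by (simp add: U'_def power_eq_if)
    finally show ?thesis .
  qed
  moreover have "Y z = 0" if "U' z = 0" for z using that by (intro Y(3)) (simp add: U'_def)
  moreover have "f' holomorphic_on ball 0 4"
    using holomorphic_on_compose_gen[OF f(1) g image_subsetI[OF f5]] by (simp add: f'_def o_def)
  moreover have "f' 0 = 0" using gfix[of 0] Y0 by (simp add: f'_def f)
  moreover have "deriv f' 0 = exp (2 * of_real pi * \<i> * of_real (\<alpha> + t))"
  proof -
    have "(f has_field_derivative deriv f 0) (at 0)" using f(1) holomorphic_derivI[of f "ball 0 4" 0] by simp
    moreover have "(g has_field_derivative deriv g 0) (at (f 0))"
      using g holomorphic_derivI[of g "ball 0 5" 0] f(2) by simp
    ultimately have "deriv f' 0 = deriv g 0 * deriv f 0"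
      unfolding f'_def using DERIV_chain2 DERIV_imp_deriv by blast
    also have "\<dots> = exp (2 * of_real pi * \<i> * of_real (\<alpha> + t))"
      unfolding dg f(3) by (simp add: exp_add[symmetric] algebra_simps)
    finally show ?thesis .
  qed
  moreover have "norm (f' z - z) \<le> 1/2 - 1 / 2 ^ Suc (Suc n)" if "z \<in> ball 0 4" for z
  proof -
    have "norm (f' z - z) \<le> norm (f' z - f z) + norm (f z - z)"
      using norm_triangle_ineq[of "f' z - f z" "f z - z"] by simp
    also have "\<dots> \<le> 1 / 2 ^ (n + 2) + (1/2 - 1 / 2 ^ Suc n)" by (intro add_mono f'n fn that)
    finally show ?thesis by simp
  qed
  \<comment> \<open>The flow at time \<open>1 / (q * m)\<close> multiplies \<open>V\<close> by
    \<open>exp (2 * pi * \<i> / m)\<close>, which the \<open>m\<close>-th power removes;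
    \<open>f\<close> already preserves \<open>V\<close>.\<close>
  moreover have "U' (f' z) = U' z" if "z \<in> ball 0 4" for z
  proof -
    have "U' (f' z) = exp (2 * of_real pi * \<i> * of_nat q * of_real t) ^ m * V (f z) ^ m"
      unfolding U'_def f'_def gV[OF f5[OF that]] by (rule power_mult_distrib)
    also have "exp (2 * of_real pi * \<i> * of_nat q * of_real t) ^ m = exp (of_nat m * (2 * of_real pi * \<i> * of_nat q * of_real t))"
      by (rule exp_of_nat_mult[symmetric])
    also have "of_nat m * (2 * of_real pi * \<i> * of_nat q * of_real t) = 2 * of_real pi * \<i> * of_real (real q' * t)"
      by (simp add: q'_def)
    also have "real q' * t = 1" using q' by (simp add: t_def)
    also have "V (f z) = V z" using fU[OF that] by (simp add: V_def)
    finally show ?thesis by (simp add: U'_def)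
  qed
  moreover have \<Psi>'h: "\<Psi>' holomorphic_on ball 0 s'"
    using holomorphic_on_compose_gen[OF L(1) \<Psi>(1) Lsub] by (simp add: \<Psi>'_def o_def)
  moreover have \<Psi>'i: "inj_on \<Psi>' (ball 0 s')"
    using comp_inj_on[OF L(2) inj_on_subset[OF \<Psi>(2) Lsub]] by (simp add: \<Psi>'_def o_def)
  moreover have "\<Psi>' 0 = 0" by (simp add: \<Psi>'_def L \<Psi>)
  moreover have "\<Psi>' ` ball 0 s' \<subseteq> ball 0 2" using Lsub \<Psi>(4) unfolding \<Psi>'_def by blast
  moreover have "U' (\<Psi>' w) = w ^ q'" if w: "w \<in> ball 0 s'" for w
  proof -
    have "U (\<Psi>' w) = T (w ^ q)" using U\<Psi>[of "L w"] Lsub w L(4)[OF w] unfolding \<Psi>'_def by (metis image_subset_iff)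
    moreover have "w ^ q \<in> ball 0 \<rho>'" using w ball_power_root[OF q \<rho>'0, of w] by (simp add: s'_def)
    ultimately show ?thesis using T(6) by (simp add: U'_def V_def q'_def power_mult)
  qed
  moreover have "1 < emeasure lborel (\<Psi>' ` ball 0 s')"
  proof -
    have "{w \<in> ball 0 s. w ^ q \<in> \<Theta> ` ball 0 \<rho>} \<subseteq> L ` ball 0 s'" using L(5) T(5) by blast
    hence "\<Psi> ` {w \<in> ball 0 s. w ^ q \<in> \<Theta> ` ball 0 \<rho>} \<subseteq> \<Psi>' ` ball 0 s'" unfolding \<Psi>'_def by blast
    moreover have "open (\<Psi>' ` ball 0 s')" by (rule open_mapping_thm3[OF \<Psi>'h open_ball \<Psi>'i])
    ultimately have "emeasure lborel (\<Psi> ` {w \<in> ball 0 s. w ^ q \<in> \<Theta> ` ball 0 \<rho>}) \<le> emeasure lborel (\<Psi>' ` ball 0 s')"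
      by (intro emeasure_mono) (simp_all add: borel_open)
    with \<rho>(3) show ?thesis by (rule less_le_trans)
  qed
  ultimately have "valid_stage (Suc n) S'"
    using q' s' Y unfolding valid_stage_def Let_def S'_def by simp
  moreover have "next_stage n S S'"
  proof -
    have "(n + 2) * q \<le> m * q" using m(1) by (intro mult_le_mono1)
    hence "(n + 2) * q \<le> q'" by (simp only: q'_def mult.commute)
    moreover have "f' z = f z" if "z \<in> ball 0 4" "U' (f z) = 0" for z
      using that Y(3) gfix[OF f5] by (simp add: U'_def f'_def)
    moreover have "U' z = 0" if "U z = 0" for z using that m0 by (simp add: U'_def V_def F)
    moreover have "\<exists>\<delta>. \<delta> \<noteq> 0 \<and> (f ^^ q) \<delta> = \<delta> \<and>
         (\<forall>k. norm ((f ^^ k) \<delta>) < 1 / real (Suc n) \<and> U' ((f ^^ k) \<delta>) = 0)"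
    proof -
      \<comment> \<open>In the chart the orbit is \<open>\<zeta> ^ k * w\<close>, and all its points
        have \<open>q\<close>-th power \<open>b\<close>; so \<open>U\<close> equals \<open>b\<close>
        along it and \<open>F (U)\<close> vanishes.\<close>
      obtain w where w: "b = w ^ q" using exists_complex_root[of q b] q by auto
      have wn: "norm w < \<epsilon>"
        using b(3) \<epsilon>(1) unfolding w \<eta>_def norm_power by (simp add: power_less_imp_less_base)
      have w0: "w \<noteq> 0" using b(2) w q by (auto simp: zero_power)
      have kn: "norm (\<zeta> ^ k * w) = norm w" for k by (simp add: norm_mult norm_power \<zeta>n)
      have ks: "\<zeta> ^ k * w \<in> ball 0 s" for k using wn \<epsilon>(2) kn[of k] by simp
      have it: "(f ^^ k) (\<Psi> w) = \<Psi> (\<zeta> ^ k * w)" for k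
      proof (induction k)
        case (Suc k)
        show ?case using rot[OF ks[of k]] Suc by (simp add: mult.assoc)
      qed simp
      have "U' ((f ^^ k) (\<Psi> w)) = 0" for k
      proof -
        have "U ((f ^^ k) (\<Psi> w)) = (\<zeta> ^ q) ^ k * w ^ q"
          unfolding it U\<Psi>[OF ks] by (simp add: power_mult_distrib power_mult[symmetric] mult.commute)
        thus ?thesis using b(1) w \<zeta>q m0 by (simp add: U'_def V_def)
      qed
      moreover have "norm ((f ^^ k) (\<Psi> w)) < 1 / real (Suc n)" for k
        unfolding it using wn by (intro \<epsilon>(3)) (simp add: kn)
      moreover have "(f ^^ q) (\<Psi> w) = \<Psi> w" by (simp add: it \<zeta>q)
      moreover have "\<Psi> w \<noteq> 0"
        using \<Psi>(2,3) w0 ks[of 0] s by (metis centre_in_ball inj_onD mult_1 power_0)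
      ultimately show ?thesis by blast
    qed
    ultimately show ?thesis
      using f'n unfolding next_stage_def Let_def S'_def t_def by (simp flip: defs)
  qed
  ultimately show ?thesis by blast
qed

subsection \<open>Invariant continua of the limit\<close>

lemma jordan_domain_ball:
  assumes "R > 0" shows "jordan_domain (ball 0 R)"
  unfolding jordan_domain_def
proof (intro exI conjI)
  show "simple_path (circlepath 0 R)" using assms by (simp add: simple_path_circlepath)
  have "inside (frontier (cball (0::complex) R)) = interior (cball 0 R)"
    by (rule inside_frontier_eq_interior) auto
  thus "ball 0 R = inside (path_image (circlepath 0 R))"
    using assms by (simp add: path_image_circlepath)
qed simp

text \<open>Each closed tail union is a connected compactum, because all \<open>A n\<close> share
  the point \<open>x\<close>; a decreasing intersection of such sets is connected.\<close>

lemma connected_limsup: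
  fixes A :: "nat \<Rightarrow> 'a::euclidean_space set"
  assumes A: "\<And>n. connected (A n)" "\<And>n. x \<in> A n" "\<And>n. A n \<subseteq> cball x r"
  shows "compact (\<Inter>N. closure (\<Union>n\<in>{N..}. A n))" "connected (\<Inter>N. closure (\<Union>n\<in>{N..}. A n))"
proof -
  define C where "C = (\<lambda>N. closure (\<Union>n\<in>{N..}. A n))"
  have sub: "C N \<subseteq> cball x r" for N unfolding C_def using A(3) by (intro closure_minimal) auto
  have comp: "compact (C N)" for N
    using sub[of N] by (auto simp: compact_eq_bounded_closed C_def intro: bounded_subset[OF bounded_cball])
  have conn: "connected (C N)" for N unfolding C_def
  proof (intro connected_imp_connected_closure connected_Union)
    show "\<Inter> (A ` {N..}) \<noteq> {}" using A(2) by blast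
  qed (use A(1) in auto)
  have nest: "C n \<subseteq> C m" if "m \<le> n" for m n unfolding C_def using that by (intro closure_mono UN_mono) auto
  show "compact (\<Inter>N. closure (\<Union>n\<in>{N..}. A n))"
    using comp unfolding C_def[symmetric] by (intro compact_Inter) auto
  show "connected (\<Inter>N. closure (\<Union>n\<in>{N..}. A n))"
    using connected_nest[OF comp conn nest] unfolding C_def by simp
qed

text \<open>The closed tail unions decrease, have finite measure and contain \<open>A N\<close>;
  continuity from above passes the bound to the intersection.\<close>

lemma emeasure_limsup_ge:
  fixes A :: "nat \<Rightarrow> 'a::euclidean_space set"
  assumes A: "\<And>n. A n \<subseteq> cball x r" "\<And>n. open (A n)" and c: "\<And>n. c \<le> emeasure lborel (A n)"
  shows "c \<le> emeasure lborel (\<Inter>N. closure (\<Union>n\<in>{N..}. A n))"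
proof -
  define C where "C = (\<lambda>N. closure (\<Union>n\<in>{N..}. A n))"
  have sub: "C N \<subseteq> cball x r" for N unfolding C_def using A(1) by (intro closure_minimal) auto
  have AC: "A N \<subseteq> C N" for N unfolding C_def
    by (rule subset_trans[OF _ closure_subset]) auto
  have "(INF N. emeasure lborel (C N)) = emeasure lborel (\<Inter>N. C N)"
  proof (rule INF_emeasure_decseq)
    show "decseq C" unfolding C_def by (intro decseq_SucI closure_mono UN_mono) auto
    show "emeasure lborel (C i) \<noteq> \<infinity>" for i
      by (rule less_imp_neq[OF emeasure_bounded_finite[OF bounded_subset[OF bounded_cball sub]]])
  qed (auto simp: C_def)
  moreover have "c \<le> emeasure lborel (C N)" for N
    by (rule order_trans[OF c emeasure_mono[OF AC]]) (simp add: C_def)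
  hence "c \<le> (INF N. emeasure lborel (C N))" by (intro INF_greatest)
  ultimately show ?thesis by (simp add: C_def)
qed

text \<open>A point of \<open>K\<close> is approximated by \<open>y\<close> in late
  \<open>A n\<close>, and \<open>F n y\<close> stays in \<open>A n\<close> and is close to
  \<open>f z\<close>. Conversely, preimages of approximating points under \<open>F n\<close> lie in
  \<open>A n\<close>, and a convergent subsequence of them has its limit in
  \<open>K\<close>.\<close>

lemma limsup_invariant:
  fixes f :: "complex \<Rightarrow> complex" and F :: "nat \<Rightarrow> complex \<Rightarrow> complex"
  assumes lim: "uniform_limit B F f sequentially" and f: "continuous_on B f" and B: "cball 0 r \<subseteq> B"
    and A: "\<And>n. F n ` A n = A n" "\<And>n. A n \<subseteq> cball 0 r"
  defines "K \<equiv> (\<Inter>N. closure (\<Union>n\<in>{N..}. A n))"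
  shows "f ` K = K"
proof -
  have Kr: "closure (\<Union>n\<in>{N..}. A n) \<subseteq> cball 0 r" for N using A(2) by (intro closure_minimal) auto
  hence KB: "K \<subseteq> cball 0 r" by (auto simp: K_def)
  have fr: "continuous_on (cball 0 r) f" using continuous_on_subset[OF f B] .
  have "f z \<in> K" if z: "z \<in> K" for z
  proof -
    have "f z \<in> closure (\<Union>n\<in>{N..}. A n)" for N
      unfolding closure_approachable
    proof (intro allI impI)
      fix e :: real assume e: "e > 0"
      obtain d where d: "d > 0" "\<And>y. y \<in> cball 0 r \<Longrightarrow> dist y z < d \<Longrightarrow> dist (f y) (f z) < e/2"
        using fr[unfolded continuous_on_iff, THEN bspec, OF subsetD[OF KB z]] half_gt_zero[OF e] by blast
      obtain M where M: "\<And>n y. n \<ge> M \<Longrightarrow> y \<in> B \<Longrightarrow> dist (F n y) (f y) < e/2"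
        using uniform_limitD[OF lim, of "e/2"] e by (auto simp: eventually_sequentially)
      have "z \<in> closure (\<Union>n\<in>{max M N..}. A n)" using z unfolding K_def by blast
      then obtain n y where n: "n \<ge> max M N" "y \<in> A n" "dist y z < d"
        using d(1) unfolding closure_approachable by fastforce
      have y: "y \<in> cball 0 r" using A(2) n(2) by blast
      have "dist (F n y) (f y) < e/2" using M n(1) y B by auto
      hence "dist (F n y) (f z) < e" using d(2)[OF y n(3)] by (metis dist_triangle_half_l dist_commute)
      moreover have "F n y \<in> A n" using A(1) n(2) by blast
      ultimately show "\<exists>x\<in>(\<Union>n\<in>{N..}. A n). dist x (f z) < e" using n(1) by (intro bexI[of _ "F n y"]) auto
    qed
    thus ?thesis by (simp add: K_def)
  qed
  moreover have "\<exists>y\<in>K. f y = z" if z: "z \<in> K" for z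
  proof -
    have "\<exists>n y. n \<ge> j \<and> y \<in> A n \<and> dist (F n y) z < 1 / real (Suc j)" for j
    proof -
      have "z \<in> closure (\<Union>n\<in>{j..}. A n)" using z unfolding K_def by blast
      then obtain n x where n: "n \<ge> j" "x \<in> A n" "dist x z < 1 / real (Suc j)"
        unfolding closure_approachable by (metis UN_iff atLeast_iff of_nat_0_less_iff zero_less_Suc zero_less_divide_1_iff)
      hence "x \<in> F n ` A n" using A(1) by simp
      then obtain y where "y \<in> A n" "x = F n y" by (rule imageE)
      thus ?thesis using n by (intro exI[of _ n] exI[of _ y]) simp
    qed
    then obtain n y where n: "\<And>j. n j \<ge> j" and y: "\<And>j. y j \<in> A (n j)"
      and yz: "\<And>j. dist (F (n j) (y j)) z < 1 / real (Suc j)" by metis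
    have yB: "y j \<in> cball 0 r" for j using y A(2) by blast
    obtain l \<rho> where l: "l \<in> cball 0 r" and \<rho>: "strict_mono (\<rho> :: nat \<Rightarrow> nat)" and yl: "(y \<circ> \<rho>) \<longlonglongrightarrow> l"
      using compact_cball[of "0::complex" r] yB unfolding compact_def by metis
    have "l \<in> K" unfolding K_def
    proof
      fix N
      show "l \<in> closure (\<Union>n\<in>{N..}. A n)"
      proof (rule Lim_in_closed_set[OF closed_closure _ _ yl])
        show "eventually (\<lambda>j. (y \<circ> \<rho>) j \<in> closure (\<Union>n\<in>{N..}. A n)) sequentially"
          unfolding eventually_sequentially
        proof (intro exI allI impI)
          fix j assume "N \<le> j"
          hence "N \<le> n (\<rho> j)" using n seq_suble[OF \<rho>] le_trans by metis
          hence "y (\<rho> j) \<in> (\<Union>n\<in>{N..}. A n)" using y by blast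
          thus "(y \<circ> \<rho>) j \<in> closure (\<Union>n\<in>{N..}. A n)"
            unfolding o_def by (rule subsetD[OF closure_subset])
        qed
      qed auto
    qed
    moreover have "f l = z"
    proof (rule LIMSEQ_unique)
      show "(\<lambda>j. f ((y \<circ> \<rho>) j)) \<longlonglongrightarrow> f l"
        by (rule continuous_on_tendsto_compose[OF fr yl l]) (simp add: yB[unfolded mem_cball_0])
      have "(\<lambda>j. f ((y \<circ> \<rho>) j) - z) \<longlonglongrightarrow> 0"
      proof (rule tendstoI)
        fix e :: real assume e: "e > 0"
        obtain M where M: "\<And>n y. n \<ge> M \<Longrightarrow> y \<in> B \<Longrightarrow> dist (F n y) (f y) < e/2"
          using uniform_limitD[OF lim, of "e/2"] e by (auto simp: eventually_sequentially)
        obtain N where N: "inverse (real (Suc N)) < e/2" using reals_Archimedean[of "e/2"] e by auto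
        have "dist (f ((y \<circ> \<rho>) j) - z) 0 < e" if j: "j \<ge> max M N" for j
        proof -
          have \<rho>j: "\<rho> j \<ge> j" using seq_suble[OF \<rho>] .
          hence "dist (F (n (\<rho> j)) (y (\<rho> j))) (f (y (\<rho> j))) < e/2"
            using j n[of "\<rho> j"] yB B by (intro M) auto
          moreover have "dist (F (n (\<rho> j)) (y (\<rho> j))) z < e/2"
          proof -
            have "1 / real (Suc (\<rho> j)) \<le> inverse (real (Suc N))"
              using \<rho>j j by (simp add: inverse_eq_divide frac_le)
            thus ?thesis using yz[of "\<rho> j"] N by linarith
          qed
          ultimately have "dist (f (y (\<rho> j))) z < e" by (metis dist_triangle_half_r)
          thus ?thesis by (simp add: dist_norm)
        qed
        thus "eventually (\<lambda>j. dist (f ((y \<circ> \<rho>) j) - z) 0 < e) sequentially"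
          unfolding eventually_sequentially by blast
      qed
      thus "(\<lambda>j. f ((y \<circ> \<rho>) j)) \<longlonglongrightarrow> z" by (simp add: LIM_zero_iff)
    qed
    ultimately show ?thesis by blast
  qed
  ultimately show ?thesis by blast
qed

text \<open>If a point of a bounded component of the complement were exchanged with a point of the
  unbounded component \<open>O\<close>, then a bounded relatively clopen set would fill \<open>O\<close>.\<close>

lemma inside_invariant:
  fixes f :: "complex \<Rightarrow> complex"
  assumes f: "f holomorphic_on ball 0 3" "inj_on f (ball 0 3)"
    and near: "\<And>z. z \<in> ball 0 3 \<Longrightarrow> norm (f z - z) \<le> 1/2"
    and K: "compact K" "K \<subseteq> cball 0 2" "f ` K = K"
  shows "f ` inside K = inside K"
proof -
  have clK: "closed K" and bK: "bounded K" using K compact_imp_closed compact_imp_bounded by auto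
  have KB: "K \<subseteq> ball 0 3" using K(2) by auto
  have "- cball 0 2 \<subseteq> outside K" using K(2) by (intro outside_subset_convex) auto
  hence inK: "inside K \<subseteq> cball 0 2" using inside_Int_outside[of K] by blast
  have oin: "open (inside K)" and oout: "open (outside K)"
    using clK by (auto intro: open_inside open_outside)
  have conn: "connected (outside K)" by (rule connected_outside[OF bK]) simp
  have unb: "\<not> bounded (outside K)" by (rule unbounded_outside[OF bK])
  have inKf: "z \<in> K" if "z \<in> ball 0 3" "f z \<in> K" for z
  proof -
    obtain y where "y \<in> K" "f y = f z" using K(3) \<open>f z \<in> K\<close> by (metis imageE)
    thus ?thesis using f(2) KB that(1) by (metis inj_onD subsetD)
  qed
  have contf: "continuous_on (ball 0 3) f" using f(1) holomorphic_on_imp_continuous_on by blast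
  have sub: "f z \<in> inside K" if z: "z \<in> inside K" for z
  proof (rule ccontr)
    assume nin: "f z \<notin> inside K"
    have inB: "inside K \<subseteq> ball 0 3" using inK by auto
    have notK: "f z \<notin> K" if "z \<in> inside K" for z using inKf that inB by (metis inside_no_overlap disjoint_iff subsetD)
    have fzo: "f z \<in> outside K" using nin notK[OF z] by (auto simp: outside_inside)
    \<comment> \<open>Open because \<open>f\<close> is an open map. Relatively closed because the
      closure of \<open>inside K\<close> adds only points of \<open>K\<close>, whose images stay in
      \<open>K\<close>.\<close>
    define A where "A = f ` inside K \<inter> outside K"
    have "open (f ` inside K)"
      using oin inB by (intro open_mapping_thm3 holomorphic_on_subset[OF f(1)] inj_on_subset[OF f(2)])
    hence "openin (top_of_set (outside K)) A" unfolding A_def by (simp add: openin_open_Int Int_commute)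
    moreover have "closedin (top_of_set (outside K)) A"
    proof -
      have "compact (f ` closure (inside K))"
      proof (rule compact_continuous_image)
        have "closure (inside K) \<subseteq> cball 0 2" using inK by (intro closure_minimal) auto
        thus "continuous_on (closure (inside K)) f" by (intro continuous_on_subset[OF contf]) auto
        show "compact (closure (inside K))" using bounded_inside[OF bK] by (simp add: compact_closure)
      qed
      hence "closedin (top_of_set (outside K)) (outside K \<inter> f ` closure (inside K))"
        by (intro closedin_closed_Int compact_imp_closed)
      moreover have "outside K \<inter> f ` closure (inside K) = A"
      proof -
        have "f ` closure (inside K) \<subseteq> f ` (K \<union> inside K)" using closure_inside_subset[OF clK] by blast
        hence "f ` closure (inside K) \<subseteq> K \<union> f ` inside K" using K(3) by blast
        moreover have "f ` inside K \<subseteq> f ` closure (inside K)" using closure_subset by blast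
        ultimately show ?thesis unfolding A_def using outside_no_overlap[of K] by blast
      qed
      ultimately show ?thesis by simp
    qed
    moreover have "A \<noteq> {}" unfolding A_def using fzo z by blast
    ultimately have "A = outside K" using conn connected_clopen by blast
    moreover have "bounded A"
    proof -
      have "f ` inside K \<subseteq> cball 0 3"
      proof
        fix y assume "y \<in> f ` inside K"
        then obtain x where x: "x \<in> inside K" "y = f x" by blast
        have "norm x \<le> 2" "norm (f x - x) \<le> 1/2" using x inK inB near by auto
        thus "y \<in> cball 0 3" using norm_triangle_sub[of "f x" x] x by simp
      qed
      thus ?thesis unfolding A_def by (meson bounded_cball bounded_subset inf.coboundedI1)
    qed
    ultimately show False using unb by simp
  qed
  have "\<exists>z\<in>inside K. f z = y" if y: "y \<in> inside K" for y
  proof -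
    have y2: "norm y \<le> 2" using y inK by auto
    \<comment> \<open>A preimage of \<open>y\<close> by Brouwer; the radius is 2 plus the
      displacement 1/2.\<close>
    obtain z where z: "z \<in> cball 0 (5/2)" "y - (f z - z) = z"
    proof (rule brouwer_ball[of "5/2" 0 "\<lambda>z. y - (f z - z)"])
      show "continuous_on (cball 0 (5/2)) (\<lambda>z. y - (f z - z))"
        by (intro continuous_intros continuous_on_subset[OF contf]) auto
      show "(\<lambda>z. y - (f z - z)) \<in> cball 0 (5/2) \<rightarrow> cball 0 (5/2)"
      proof
        fix z :: complex assume "z \<in> cball 0 (5/2)"
        hence "norm (f z - z) \<le> 1/2" by (intro near) auto
        thus "y - (f z - z) \<in> cball 0 (5/2)" using y2 norm_triangle_ineq4[of y "f z - z"] by simp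
      qed
    qed auto
    have zB: "z \<in> ball 0 3" using z(1) by auto
    have fz: "f z = y" using z(2) by (simp add: algebra_simps)
    have "z \<in> inside K"
    proof (rule ccontr)
      assume nin: "z \<notin> inside K"
      have "z \<notin> K"
      proof
        assume "z \<in> K"
        hence "y \<in> K" using K(3) fz by blast
        thus False using y inside_no_overlap by blast
      qed
      hence zo: "z \<in> outside K" using nin by (auto simp: outside_inside)
      \<comment> \<open>The same clopen argument for the preimage of \<open>inside K\<close>. It
        lies in the ball of radius 5/2, hence away from the boundary of the domain of
        \<open>f\<close>, which makes it relatively closed in \<open>outside K\<close>.\<close>
      define P where "P = ball 0 3 \<inter> f -` inside K"
      have P2: "x \<in> cball 0 (5/2)" if "x \<in> P" for x
      proof -
        have "norm (f x) \<le> 2" "norm (f x - x) \<le> 1/2" using that inK near by (auto simp: P_def)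
        thus ?thesis using norm_triangle_sub[of x "f x"] by (simp add: norm_minus_commute)
      qed
      have "open P" unfolding P_def by (rule continuous_open_preimage[OF contf open_ball oin])
      hence "openin (top_of_set (outside K)) (outside K \<inter> P)" by (simp add: openin_open_Int)
      moreover have "closedin (top_of_set (outside K)) (outside K \<inter> P)"
      proof -
        define Q where "Q = cball 0 (5/2) \<inter> f -` (K \<union> inside K)"
        have "closed (K \<union> inside K)" using oout by (simp add: union_with_inside closed_Compl)
        moreover have "continuous_on (cball 0 (5/2)) f" by (rule continuous_on_subset[OF contf]) auto
        ultimately have "closed Q" unfolding Q_def by (intro continuous_closed_preimage) auto
        moreover have "outside K \<inter> Q = outside K \<inter> P"
        proof (intro equalityI subsetI)
          fix x assume x: "x \<in> outside K \<inter> Q"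
          hence xB: "x \<in> ball 0 3" by (auto simp: Q_def)
          have "f x \<notin> K" using inKf[OF xB] x outside_no_overlap[of K] by blast
          thus "x \<in> outside K \<inter> P" using x xB by (auto simp: P_def Q_def)
        next
          fix x assume "x \<in> outside K \<inter> P"
          thus "x \<in> outside K \<inter> Q" using P2[of x] by (auto simp: P_def Q_def)
        qed
        ultimately show ?thesis by (metis closedin_closed_Int)
      qed
      moreover have "outside K \<inter> P \<noteq> {}" using zo zB fz y by (auto simp: P_def)
      ultimately have "outside K \<inter> P = outside K" using conn connected_clopen by blast
      hence "outside K \<subseteq> cball 0 (5/2)" using P2 by blast
      thus False using unb bounded_subset[OF bounded_cball] by blast
    qed
    thus ?thesis using fz by blast
  qed
  thus ?thesis using sub by blast
qed

lemma siegel_compactum_filled: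
  assumes f: "f holomorphic_on ball 0 3" "inj_on f (ball 0 3)"
    and near: "\<And>z. z \<in> ball 0 3 \<Longrightarrow> norm (f z - z) \<le> 1/2"
    and K: "compact K" "connected K" "0 \<in> K" "K \<noteq> {0}" "K \<subseteq> cball 0 2" "f ` K = K"
  shows "\<exists>W U. siegel_compactum f W U (K \<union> inside K)"
proof -
  define H where "H = K \<union> inside K"
  have clK: "closed K" and bK: "bounded K" using K compact_imp_closed compact_imp_bounded by auto
  have "- cball 0 2 \<subseteq> outside K" using K(5) by (intro outside_subset_convex) auto
  hence H2: "H \<subseteq> cball 0 2" unfolding H_def union_with_inside by blast
  have cH: "compact H" unfolding compact_eq_bounded_closed
    using bounded_inside[OF bK] bK open_outside[OF clK] by (simp add: H_def) (simp add: union_with_inside closed_Compl)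
  have fH: "f ` H = H" using inside_invariant[OF f near K(1,5,6)] K(6) by (simp add: H_def image_Un)
  obtain x where x: "x \<in> H" "\<And>y. y \<in> H \<Longrightarrow> norm y \<le> norm x"
    using continuous_attains_sup[OF cH, of norm] K(3) by (auto simp: H_def intro: continuous_on_norm_id)
  define R where "R = norm x"
  obtain y where "y \<in> K" "y \<noteq> 0" using K(3,4) by blast
  hence R: "R > 0" using x(2)[of y] by (simp add: R_def H_def) (metis norm_le_zero_iff not_le order_trans zero_less_norm_iff)
  have R2: "R \<le> 2" using x(1) H2 by (auto simp: R_def)
  have "siegel_compactum f (ball 0 3) (ball 0 R) H"
    unfolding siegel_compactum_def
  proof (intro conjI)
    show "jordan_domain (ball 0 R)" by (rule jordan_domain_ball[OF R])
    show "closure (ball 0 R) \<subseteq> ball (0::complex) 3" using R R2 by auto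
    show "connected H" unfolding H_def by (rule connected_with_inside[OF clK K(2)])
    show "full H" unfolding full_def H_def union_with_inside using connected_outside[OF bK] by simp
    show "H \<subseteq> closure (ball 0 R)" using x(2) R by (auto simp: R_def)
    have "x \<in> H \<inter> frontier (ball 0 R)" using x(1) R by (simp add: R_def)
    thus "H \<inter> frontier (ball 0 R) \<noteq> {}" by blast
    show "{z \<in> ball 0 3. f z \<in> H} = H"
    proof (intro equalityI subsetI)
      fix z assume z: "z \<in> {z \<in> ball 0 3. f z \<in> H}"
      then obtain y where y: "y \<in> H" "f y = f z" using fH by (metis (no_types, lifting) imageE mem_Collect_eq)
      have "y \<in> ball 0 3" using y(1) H2 by auto
      thus "z \<in> H" using f(2) z y by (metis (no_types, lifting) inj_onD mem_Collect_eq)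
    next
      fix z assume "z \<in> H"
      thus "z \<in> {z \<in> ball 0 3. f z \<in> H}" using H2 fH by auto
    qed
  qed (use f cH fH R K(3) in \<open>auto simp: H_def\<close>)
  thus ?thesis unfolding H_def by blast
qed

subsection \<open>The limit germ\<close>

text \<open>At \<open>n = 0\<close> the displacement bound is 0, which the identity meets; the unit
  disc has area \<open>pi > 1\<close>.\<close>

lemma valid_stage_0:
  "valid_stage 0 \<lparr>period = 1, angle = 0, integral_map = (\<lambda>z. z), vfield = (\<lambda>z. 2 * of_real pi * \<i> * z),
     germ = (\<lambda>z. z), chart = (\<lambda>z. z), radius = 1\<rparr>"
proof -
  have "deriv (\<lambda>z. 2 * of_real pi * \<i> * z) 0 = 2 * of_real pi * \<i>"
    by (intro DERIV_imp_deriv) (auto intro!: derivative_eq_intros)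
  moreover have "1 < emeasure lborel (ball (0::complex) 1)"
  proof -
    have "emeasure lborel (ball (0::complex) 1) = ennreal pi"
      by (simp add: emeasure_ball unit_ball_vol_2)
    moreover have "ennreal 1 < ennreal pi" using pi_gt3 by (intro ennreal_lessI) auto
    ultimately show ?thesis by simp
  qed
  ultimately show ?thesis
    unfolding valid_stage_def Let_def by (auto intro!: holomorphic_intros)
qed

text \<open>Liouville's argument: \<open>q\<^sub>n (\<alpha> - \<alpha>\<^sub>n)\<close> is positive and tends to \<open>0\<close>.\<close>

lemma irrational_limit:
  fixes \<alpha> :: "nat \<Rightarrow> real" and q :: "nat \<Rightarrow> nat"
  assumes q: "\<And>n. 0 < q n" "\<And>n. (n + 2) * q n \<le> q (Suc n)" and int: "\<And>n. real (q n) * \<alpha> n \<in> \<int>"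
    and \<alpha>: "\<And>n. \<alpha> (Suc n) = \<alpha> n + 1 / real (q (Suc n))"
  obtains a where "\<alpha> \<longlonglongrightarrow> a" "a \<notin> \<rat>"
proof -
  \<comment> \<open>An upper bound for the limit: the remaining increments at least halve each time,
    so they sum to at most twice the first. Hence \<open>\<beta>\<close> decreases.\<close>
  define \<beta> where "\<beta> = (\<lambda>n. \<alpha> n + 2 / real (q (Suc n)))"
  have inc: "incseq \<alpha>" by (intro incseq_SucI) (simp add: \<alpha>)
  have "decseq \<beta>"
  proof (rule decseq_SucI)
    fix n
    have "2 * real (q (Suc n)) \<le> real (Suc n + 2) * real (q (Suc n))" by (intro mult_right_mono) auto
    also have "\<dots> \<le> real (q (Suc (Suc n)))" using q(2)[of "Suc n"] by (metis of_nat_le_iff of_nat_mult)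
    finally have "2 / real (q (Suc (Suc n))) \<le> 1 / real (q (Suc n))" using q(1) by (simp add: field_simps)
    thus "\<beta> (Suc n) \<le> \<beta> n" by (simp add: \<beta>_def \<alpha>)
  qed
  hence dec: "\<beta> n \<le> \<beta> m" if "m \<le> n" for m n using that by (simp add: decseq_def)
  have ab: "\<alpha> m \<le> \<beta> n" for m n
  proof -
    have "\<alpha> m \<le> \<alpha> (max m n)" using inc by (simp add: incseq_def)
    also have "\<dots> \<le> \<beta> (max m n)" by (simp add: \<beta>_def)
    also have "\<dots> \<le> \<beta> n" by (intro dec) simp
    finally show ?thesis .
  qed
  obtain a where a: "\<alpha> \<longlonglongrightarrow> a" "\<forall>i. \<alpha> i \<le> a"
    by (rule incseq_convergent[OF inc]) (use ab[of _ 0] in auto)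
  have a\<beta>: "a \<le> \<beta> n" for n using LIMSEQ_le_const2[OF a(1)] ab by blast
  have "a \<notin> \<rat>"
  proof
    assume "a \<in> \<rat>"
    then obtain r :: int and d :: nat where d: "d > 0" "a = of_int r / of_nat d"
      by (elim Rats_cases') (metis of_int_of_nat_eq zero_less_imp_eq_int of_nat_0_less_iff)
    \<comment> \<open>For a limit with denominator \<open>d\<close>, the integer \<open>x\<close>
      below is positive and at most \<open>2 * d / (n + 2)\<close>, which this choice makes less
      than 1.\<close>
    define n where "n = 2 * d"
    define x where "x = real d * real (q n) * (a - \<alpha> n)"
    have "x = real (q n) * of_int r - real d * (real (q n) * \<alpha> n)" using d by (simp add: x_def field_simps)
    hence "x \<in> \<int>" using int by simp
    moreover have "x > 0"
    proof -
      have "\<alpha> n < \<alpha> (Suc n)" using q(1) by (simp add: \<alpha>)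
      also have "\<dots> \<le> a" using a(2) by blast
      finally show ?thesis using d q(1)[of n] by (simp add: x_def)
    qed
    moreover have "x < 1"
    proof -
      have "real (n + 2) * real (q n) \<le> real (q (Suc n))" using q(2)[of n] by (metis of_nat_le_iff of_nat_mult)
      hence "2 / real (q (Suc n)) \<le> 2 / (real (n + 2) * real (q n))"
        using q(1)[of n] q(1)[of "Suc n"] by (intro divide_left_mono mult_pos_pos) auto
      hence "a - \<alpha> n \<le> 2 / (real (n + 2) * real (q n))" using a\<beta>[of n] by (simp add: \<beta>_def)
      hence "x \<le> real d * real (q n) * (2 / (real (n + 2) * real (q n)))"
        unfolding x_def by (intro mult_left_mono) auto
      also have "\<dots> = 2 * real d / real (n + 2)"
      proof -
        have "D * Q * (2 / (N * Q)) = 2 * D / N" if "Q > 0" for D Q N :: real using that by simp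
        thus ?thesis using q(1)[of n] by simp
      qed
      also have "\<dots> < 1" by (simp add: n_def)
      finally show ?thesis .
    qed
    ultimately show False by (auto elim!: Ints_cases)
  qed
  thus ?thesis using that a(1) by blast
qed

text \<open>Along a cycle inside the ball where the conjugacy equation holds,
  \<open>h z = \<zeta> ^ q * h z\<close>. Irrationality excludes \<open>\<zeta> ^ q = 1\<close>, so
  \<open>h z = 0 = h 0\<close>, against injectivity.\<close>

lemma not_linearizable_small_cycles:
  assumes \<alpha>: "\<alpha> \<notin> \<rat>"
    and cyc: "\<And>r. r > 0 \<Longrightarrow> \<exists>z q. z \<noteq> 0 \<and> 0 < q \<and> (f ^^ q) z = z \<and> (\<forall>k. norm ((f ^^ k) z) < r)"
  shows "\<not> linearizable f \<alpha>"
proof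
  assume "linearizable f \<alpha>"
  then obtain V h r where V: "open V" "0 \<in> V" and h: "inj_on h V" "h 0 = 0" and r: "r > 0"
    and conj: "\<And>z. z \<in> ball 0 r \<Longrightarrow> z \<in> V \<and> f z \<in> V \<and> h (f z) = rot \<alpha> (h z)"
    unfolding linearizable_def by blast
  define \<zeta> where "\<zeta> = exp (2 * of_real pi * \<i> * of_real \<alpha>)"
  obtain z q where z: "z \<noteq> 0" "0 < q" "(f ^^ q) z = z" "\<And>k. norm ((f ^^ k) z) < r" using cyc[OF r] by blast
  have "h ((f ^^ k) z) = \<zeta> ^ k * h z" for k
  proof (induction k)
    case (Suc k)
    have "h (f ((f ^^ k) z)) = rot \<alpha> (h ((f ^^ k) z))" using conj z(4)[of k] by simp
    thus ?case using Suc by (simp add: rot_def \<zeta>_def)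
  qed simp
  hence "h z = \<zeta> ^ q * h z" using z(3) by metis
  hence "(\<zeta> ^ q - 1) * h z = 0" by (simp add: algebra_simps)
  moreover have "\<zeta> ^ q \<noteq> 1"
  proof
    assume "\<zeta> ^ q = 1"
    hence "exp (of_nat q * (2 * of_real pi * \<i> * of_real \<alpha>)) = 1" unfolding \<zeta>_def exp_of_nat_mult .
    then obtain n :: int where "Im (of_nat q * (2 * of_real pi * \<i> * of_real \<alpha>)) = of_int (2 * n) * pi"
      unfolding exp_eq_1 by blast
    hence "real q * \<alpha> = of_int n" by simp
    hence "\<alpha> = of_int n / real q" using z(2) by (simp add: field_simps)
    thus False using \<alpha> by simp
  qed
  ultimately have "h z = h 0" using h(2) by simp
  moreover have "z \<in> V" using conj[of z] z(4)[of 0] by simp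
  ultimately show False using h(1) V(2) z(1) by (meson inj_onD)
qed

text \<open>All points of the cycle are zeros of every later integral map, and
  \<open>germ (S m)\<close> sends each of them to another one; there the next germ agrees with
  \<open>germ (S m)\<close>.\<close>

lemma next_stage_cycles_persist:
  assumes val: "\<And>n. valid_stage n (S n)" and nxt: "\<And>n. next_stage n (S n) (S (Suc n))"
  obtains z where "z \<noteq> 0" "(germ (S n) ^^ period (S n)) z = z" "\<And>k. norm ((germ (S n) ^^ k) z) < 1 / real (Suc n)"
    "\<And>m k. m \<ge> n \<Longrightarrow> germ (S m) ((germ (S n) ^^ k) z) = (germ (S n) ^^ Suc k) z"
proof -
  have nxt1: "\<forall>z\<in>ball 0 4. integral_map (S (Suc m)) (germ (S m) z) = 0 \<longrightarrow> germ (S (Suc m)) z = germ (S m) z"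
    and nxt2: "\<forall>z. integral_map (S m) z = 0 \<longrightarrow> integral_map (S (Suc m)) z = 0" for m
    using nxt[of m] unfolding next_stage_def Let_def by blast+
  obtain z where z: "z \<noteq> 0" "(germ (S n) ^^ period (S n)) z = z"
    "\<And>k. norm ((germ (S n) ^^ k) z) < 1 / real (Suc n) \<and> integral_map (S (Suc n)) ((germ (S n) ^^ k) z) = 0"
    using nxt[of n] unfolding next_stage_def Let_def by blast
  have zero: "integral_map (S (Suc m)) ((germ (S n) ^^ k) z) = 0" if "m \<ge> n" for m k using that
  proof (induction m rule: dec_induct)
    case base
    show ?case using z(3) by blast
  next
    case (step m)
    thus ?case using nxt2 by blast
  qed
  have "germ (S m) ((germ (S n) ^^ k) z) = (germ (S n) ^^ Suc k) z" if "m \<ge> n" for m k using that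
  proof (induction m rule: dec_induct)
    case (step m)
    have "1 / real (Suc n) \<le> 1" by simp
    hence "norm ((germ (S n) ^^ k) z) < 1" using z(3)[of k] less_le_trans by blast
    hence "(germ (S n) ^^ k) z \<in> ball 0 4" by simp
    moreover have "integral_map (S (Suc m)) (germ (S m) ((germ (S n) ^^ k) z)) = 0"
      unfolding step.IH using zero[OF step.hyps(1)] by blast
    ultimately show ?case using nxt1 step.IH by simp
  qed simp
  thus ?thesis using that[of z] z by blast
qed

theorem theorem1p1:
  shows "\<exists>(f :: complex \<Rightarrow> complex) (\<alpha> :: real) K.
           irrational_rotation_germ f \<alpha> \<and> \<not> linearizable f \<alpha> \<and>
           hedgehog f \<alpha> K \<and> emeasure lborel K > 0"
proof -
  have "\<exists>S. \<forall>n. valid_stage n (S n) \<and> next_stage n (S n) (S (Suc n))"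
    by (rule dependent_nat_choice) (use valid_stage_0 next_stage_exists in blast)+
  then obtain S where val: "\<And>n. valid_stage n (S n)" and nxt: "\<And>n. next_stage n (S n) (S (Suc n))" by blast
  define F where "F = (\<lambda>n. germ (S n))"
  define \<alpha> where "\<alpha> = (\<lambda>n. angle (S n))"
  define q where "q = (\<lambda>n. period (S n))"
  define A where "A = (\<lambda>n. chart (S n) ` ball 0 (radius (S n)))"
  have q: "0 < q n" "real (q n) * \<alpha> n \<in> \<int>" and Fh: "F n holomorphic_on ball 0 4" and F0: "F n 0 = 0"
    and dF: "deriv (F n) 0 = exp (2 * of_real pi * \<i> * of_real (\<alpha> n))"
    and Fn: "\<forall>z\<in>ball 0 4. norm (F n z - z) \<le> 1/2 - 1 / 2 ^ Suc n"
    and ch: "0 < radius (S n)" "chart (S n) holomorphic_on ball 0 (radius (S n))"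
      "inj_on (chart (S n)) (ball 0 (radius (S n)))" "chart (S n) 0 = 0" "A n \<subseteq> ball 0 2"
      "1 < emeasure lborel (A n)" for n
    using val[of n] unfolding valid_stage_def Let_def F_def \<alpha>_def q_def A_def by blast+
  have step: "\<alpha> (Suc n) = \<alpha> n + 1 / real (q (Suc n))" "(n + 2) * q n \<le> q (Suc n)"
    "\<forall>z\<in>ball 0 4. norm (F (Suc n) z - F n z) \<le> 1 / 2 ^ (n + 2)" for n
    using nxt[of n] unfolding next_stage_def Let_def F_def \<alpha>_def q_def by blast+
  obtain a where a: "\<alpha> \<longlonglongrightarrow> a" "a \<notin> \<rat>" by (rule irrational_limit[OF q(1) step(2) q(2) step(1)])
  \<comment> \<open>A telescoping series, so that the M-test gives uniform convergence on the whole
    ball.\<close>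
  define f where "f = (\<lambda>z. F 0 z + (\<Sum>n. F (Suc n) z - F n z))"
  have lim: "uniform_limit (ball 0 4) F f sequentially"
  proof -
    have "uniform_limit (ball 0 4) (\<lambda>n z. \<Sum>i<n. F (Suc i) z - F i z) (\<lambda>z. \<Sum>n. F (Suc n) z - F n z) sequentially"
    proof (rule Weierstrass_m_test)
      show "norm (F (Suc n) z - F n z) \<le> (1/4) * (1/2) ^ n" if "z \<in> ball 0 4" for n z
        using step(3)[of n] that by (simp add: power_divide)
      show "summable (\<lambda>n. (1/4) * (1/2) ^ n :: real)" by (intro summable_mult summable_geometric) auto
    qed
    hence "uniform_limit (ball 0 4) (\<lambda>n z. F 0 z + (\<Sum>i<n. F (Suc i) z - F i z)) f sequentially"
      unfolding f_def by (intro uniform_limit_intros)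
    moreover have "F 0 z + (\<Sum>i<n. F (Suc i) z - F i z) = F n z" for n z
      using sum_lessThan_telescope[of "\<lambda>i. F i z" n] by simp
    ultimately show ?thesis by simp
  qed
  have plim: "(\<lambda>n. F n z) \<longlonglongrightarrow> f z" if "z \<in> ball 0 4" for z by (rule tendsto_uniform_limitI[OF lim that])
  have fh: "f holomorphic_on ball 0 4"
  proof (rule holomorphic_uniform_sequence[OF open_ball Fh])
    fix x :: complex assume "x \<in> ball 0 4"
    then obtain d where "d > 0" "cball x d \<subseteq> ball 0 4" using open_contains_cball open_ball by blast
    thus "\<exists>d. 0 < d \<and> cball x d \<subseteq> ball 0 4 \<and> uniform_limit (cball x d) F f sequentially"
      using uniform_limit_on_subset[OF lim] by blast
  qed
  have near: "norm (f z - z) \<le> 1/2" if z: "z \<in> ball 0 4" for z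
  proof -
    have "(\<lambda>n. norm (F n z - z)) \<longlonglongrightarrow> norm (f z - z)" by (intro tendsto_intros plim z)
    moreover have "norm (F n z - z) \<le> 1/2" for n
    proof -
      have "norm (F n z - z) \<le> 1/2 - 1 / 2 ^ Suc n" using Fn z by blast
      thus ?thesis by (rule order_trans) simp
    qed
    ultimately show ?thesis using LIMSEQ_le_const2 by blast
  qed
  have f0: "f 0 = 0" using plim[of 0] F0 by (simp add: LIMSEQ_const_iff)
  have df: "deriv f 0 = exp (2 * of_real pi * \<i> * of_real a)"
  proof (rule LIMSEQ_unique)
    show "(\<lambda>n. deriv (F n) 0) \<longlonglongrightarrow> deriv f 0"
      by (rule deriv_complex_uniform_limit[OF lim]) (use Fh in auto)
    show "(\<lambda>n. deriv (F n) 0) \<longlonglongrightarrow> exp (2 * of_real pi * \<i> * of_real a)"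
      unfolding dF by (intro tendsto_intros a(1))
  qed
  \<comment> \<open>Discs of radius 3/4 about points of the ball of radius 3 stay inside that of
    radius 4; Cauchy's estimate gives
    \<open>norm (deriv f z - 1) \<le> (1/2) / (3/4) = 2/3 < 1\<close>.\<close>
  have inj: "inj_on f (ball 0 3)"
  proof (rule near_identity_inj_on[where f' = "deriv f" and \<kappa> = "2/3"])
    fix z :: complex assume z: "z \<in> ball 0 3"
    have sub: "cball z (3/4) \<subseteq> ball 0 4"
    proof
      fix x assume "x \<in> cball z (3/4)"
      thus "x \<in> ball 0 4" using z norm_triangle_sub[of x z] by (simp add: dist_norm norm_minus_commute)
    qed
    have "z \<in> ball 0 4" using z by simp
    hence dz: "(f has_field_derivative deriv f z) (at z)" using fh holomorphic_derivI open_ball by blast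
    thus "(f has_field_derivative deriv f z) (at z within ball 0 3)" by (rule has_field_derivative_at_within)
    have "((\<lambda>z. f z - z) has_field_derivative deriv f z - 1) (at z)" by (intro derivative_intros dz)
    hence "deriv (\<lambda>z. f z - z) z = deriv f z - 1" by (rule DERIV_imp_deriv)
    moreover have "norm ((deriv ^^ 1) (\<lambda>z. f z - z) z) \<le> fact 1 * (1/2) / (3/4) ^ 1"
    proof (rule Cauchy_inequality)
      have h: "(\<lambda>z. f z - z) holomorphic_on cball z (3/4)"
        by (intro holomorphic_intros holomorphic_on_subset[OF fh sub])
      show "(\<lambda>z. f z - z) holomorphic_on ball z (3/4)" by (rule holomorphic_on_subset[OF h]) auto
      show "continuous_on (cball z (3/4)) (\<lambda>z. f z - z)" using h by (rule holomorphic_on_imp_continuous_on)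
      show "norm (f x - x) \<le> 1/2" if "norm (z - x) = 3/4" for x
        by (rule near[OF subsetD[OF sub]]) (simp add: dist_norm that)
    qed auto
    ultimately show "norm (deriv f z - 1) \<le> 2/3" by simp
  qed auto

  \<comment> \<open>Non-linearizability of the limit\<close>
  have nl: "\<not> linearizable f a"
  proof (rule not_linearizable_small_cycles[OF a(2)])
    fix r :: real assume "r > 0"
    then obtain n where n: "inverse (real (Suc n)) < r" using reals_Archimedean by blast
    obtain z where z: "z \<noteq> 0" "(F n ^^ q n) z = z" "\<And>k. norm ((F n ^^ k) z) < 1 / real (Suc n)"
      "\<And>m k. m \<ge> n \<Longrightarrow> F m ((F n ^^ k) z) = (F n ^^ Suc k) z"
      using next_stage_cycles_persist[OF val nxt, of n] unfolding F_def q_def by blast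
    \<comment> \<open>On the cycle the sequence \<open>F m\<close> is constant from
      \<open>m = n\<close> on, so the limit germ has the same cycle.\<close>
    have "f ((F n ^^ k) z) = (F n ^^ Suc k) z" for k
    proof (rule LIMSEQ_unique)
      have "1 / real (Suc n) \<le> 1" by simp
      hence "norm ((F n ^^ k) z) < 1" using z(3)[of k] less_le_trans by blast
      hence "(F n ^^ k) z \<in> ball 0 4" by simp
      thus "(\<lambda>m. F m ((F n ^^ k) z)) \<longlonglongrightarrow> f ((F n ^^ k) z)" by (rule plim)
      show "(\<lambda>m. F m ((F n ^^ k) z)) \<longlonglongrightarrow> (F n ^^ Suc k) z"
        by (rule tendsto_eventually) (use z(4) in \<open>auto simp: eventually_sequentially simp del: funpow.simps\<close>)
    qed
    hence "(f ^^ k) z = (F n ^^ k) z" for k by (induction k) auto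
    thus "\<exists>z q. z \<noteq> 0 \<and> 0 < q \<and> (f ^^ q) z = z \<and> (\<forall>k. norm ((f ^^ k) z) < r)"
      using z(1-3) q(1)[of n] n by (intro exI[of _ z] exI[of _ "q n"]) (auto simp: inverse_eq_divide intro: less_trans)
  qed
  have germ: "irrational_rotation_germ f a"
    unfolding irrational_rotation_germ_def using a(2) fh f0 df by (intro conjI exI[of _ "ball 0 4"]) auto

  \<comment> \<open>The invariant continuum and its filling\<close>
  define K where "K = (\<Inter>N. closure (\<Union>n\<in>{N..}. A n))"
  have A2: "A n \<subseteq> cball 0 2" for n using ch(5)[of n] ball_subset_cball by blast
  have A0: "0 \<in> A n" for n unfolding A_def using ch(1,4)[of n] by (metis centre_in_ball imageI)
  have Ac: "connected (A n)" for n unfolding A_def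
    by (intro connected_continuous_image holomorphic_on_imp_continuous_on ch) simp
  have Ao: "open (A n)" for n unfolding A_def by (rule open_mapping_thm3[OF ch(2) open_ball ch(3)])
  have FA: "F n ` A n = A n" for n
  proof -
    define \<zeta> where "\<zeta> = exp (2 * of_real pi * \<i> * of_real (\<alpha> n))"
    have n1: "norm \<zeta> = 1" by (simp add: \<zeta>_def)
    have rot: "F n (chart (S n) w) = chart (S n) (\<zeta> * w)" if "w \<in> ball 0 (radius (S n))" for w
      using valid_stage_rotation[OF val that] by (simp add: F_def \<zeta>_def \<alpha>_def)
    have "(*) \<zeta> ` ball 0 (radius (S n)) = ball 0 (radius (S n))"
    proof (intro equalityI subsetI)
      fix w :: complex assume w: "w \<in> ball 0 (radius (S n))"
      have "\<zeta> \<noteq> 0" using n1 by auto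
      hence "w = \<zeta> * (w / \<zeta>)" by simp
      moreover have "w / \<zeta> \<in> ball 0 (radius (S n))" using w n1 by (simp add: norm_divide)
      ultimately show "w \<in> (*) \<zeta> ` ball 0 (radius (S n))" by blast
    qed (auto simp: norm_mult n1)
    hence "A n = (\<lambda>w. chart (S n) (\<zeta> * w)) ` ball 0 (radius (S n))" unfolding A_def by (metis image_image)
    also have "\<dots> = F n ` A n" unfolding A_def image_image by (rule image_cong) (simp_all add: rot)
    finally show ?thesis ..
  qed
  have Kc: "compact K" "connected K" unfolding K_def by (rule connected_limsup[OF Ac A0 A2])+
  have K0: "0 \<in> K" unfolding K_def
  proof
    fix N
    have "0 \<in> (\<Union>n\<in>{N..}. A n)" using A0 by blast
    thus "0 \<in> closure (\<Union>n\<in>{N..}. A n)" by (rule subsetD[OF closure_subset])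
  qed
  have K2: "K \<subseteq> cball 0 2"
  proof -
    have "K \<subseteq> closure (\<Union>n\<in>{0..}. A n)" unfolding K_def by blast
    also have "\<dots> \<subseteq> cball 0 2" using A2 by (intro closure_minimal) auto
    finally show ?thesis .
  qed
  have K1: "1 \<le> emeasure lborel K" unfolding K_def
    by (rule emeasure_limsup_ge[OF A2 Ao]) (use ch(6) in \<open>simp add: less_imp_le\<close>)
  have "K \<noteq> {0}" using K1 by auto
  have fK: "f ` K = K" unfolding K_def
    by (rule limsup_invariant[OF lim _ _ FA A2]) (use fh in \<open>auto intro: holomorphic_on_imp_continuous_on\<close>)
  have siegel: "\<exists>W U. siegel_compactum f W U (K \<union> inside K)"
    by (rule siegel_compactum_filled[OF _ inj _ Kc K0 \<open>K \<noteq> {0}\<close> K2 fK])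
       (use fh near in \<open>auto elim: holomorphic_on_subset\<close>)
  have "K \<union> inside K \<noteq> {0}" using K0 \<open>K \<noteq> {0}\<close> by blast
  hence "hedgehog f a (K \<union> inside K)" unfolding hedgehog_def using nl siegel by (intro conjI)
  moreover have "emeasure lborel (K \<union> inside K) > 0"
  proof -
    have "closed (K \<union> inside K)"
      unfolding union_with_inside using open_outside[OF compact_imp_closed[OF Kc(1)]] by (simp add: closed_Compl)
    hence "emeasure lborel K \<le> emeasure lborel (K \<union> inside K)" by (intro emeasure_mono) auto
    thus ?thesis using K1 by (metis less_le_trans zero_less_one)
  qed
  ultimately show ?thesis using nl germ by (intro exI conjI)
qed

end
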